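(* Let $\Omega$ be a locally compact Hausdorff space, let $\sigma \in \mathcal{M}^+(\Omega)$, and let $G\colon \Omega\times\Omega \to (0,+\infty]$ be a positive, quasi-symmetric, lower semicontinuous kernel which satisfies the weak maximum principle. For $0<r<p$ and $p\ge 1$, say that the $(p,r)$-weighted norm inequality holds if there is a constant $C>0$ such that $$\Vert \mathbf{G}(f\,d\sigma)\Vert_{L^r(\Omega,\sigma)} \le C\,\Vert f\Vert_{L^p(\Omega,\sigma)} \quad \text{for all } f\in L^p(\Omega,\sigma).$$ (i) If $1<p<+\infty$ and $0<r<p$, then the $(p,r)$-weighted norm inequality holds if and only if $$\int_\Omega (\mathbf{G}\sigma)^{\frac{pr}{p-r}}\,d\sigma<+\infty.$$ (ii) If $0<q<1$ and $q<r<\infty$, then the following are equivalent: (a) there exists a positive supersolution $u\in L^r(\Omega,\sigma)$, i.e. $u\ge \mathbf{G}(u^q\,d\sigma)$ and $0<u<+\infty$ $d\sigma$-a.e. in $\Omega$; (b) there exists a positive solution $u\in L^r(\Omega,\sigma)$, i.e. $u= \mathbf{G}(u^q\,d\sigma)$ and $0<u<+\infty$ $d\sigma$-a.e. in $\Omega$; (c) the $(p,r)$-weighted norm inequality holds with $p=\frac{r}{q}$; (d) $\displaystyle \int_\Omega (\mathbf{G}\sigma)^{\frac{r}{1-q}}\,d\sigma<+\infty.$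
   Context: $\mathcal{M}^+(\Omega)$ denotes the class of all positive (nonnegative) locally finite Radon measures on $\Omega$. For a measure $\nu\in\mathcal{M}^+(\Omega)$, $\mathbf{G}\nu(x)=\int_\Omega G(x,y)\,d\nu(y)$ for $x\in\Omega$, and $\mathbf{G}(f\,d\sigma)(x)=\int_\Omega G(x,y)f(y)\,d\sigma(y)$. For $0<r<1$, $\Vert g\Vert_{L^r(\Omega,\sigma)}=\left(\int_\Omega |g|^r\,d\sigma\right)^{1/r}$ is still used, although it is only a quasi-norm. The kernel $G$ is quasi-symmetric if there is a constant $a>0$ such that $a^{-1}G(y,x)\le G(x,y)\le a\,G(y,x)$ for all $x,y\in\Omega$. The kernel $G$ satisfies the weak maximum principle if there is a constant $h\ge 1$ such that, for every $\nu\in\mathcal{M}^+(\Omega)$ and every constant $M>0$, $$\sup\{\mathbf{G}\nu(x): x\in\operatorname{supp}(\nu)\}\le M \ \Longrightarrow\ \sup\{\mathbf{G}\nu(x): x\in\Omega\}\le h\,M.$$ *)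

theory Defs
  imports "HOL-Analysis.Analysis"
begin

(* For 0 < s this is the usual power on [0,\<infinity>], with 0 to the s equal to 0 and
   \<infinity> to the s equal to \<infinity>.  Only positive exponents are used below. *)
definition epowr :: "ennreal \<Rightarrow> real \<Rightarrow> ennreal"  (infixr "epowr" 80) where
  "x epowr s = (if x = \<infinity> then \<infinity> else ennreal (enn2real x powr s))"

(* Radon measures on a locally compact Hausdorff space in the sense of the Riesz
   representation theorem: locally finite Borel measures that are outer regular on
   Borel sets and inner regular on open sets. *)
definition radon_measure :: "'a::topological_space measure \<Rightarrow> bool" where
  "radon_measure M \<longleftrightarrow>
     sets M = sets borel \<and>
     (\<forall>x. \<exists>U. open U \<and> x \<in> U \<and> emeasure M U < \<infinity>) \<and>
     (\<forall>A\<in>sets borel. emeasure M A = (INF U\<in>{U. open U \<and> A \<subseteq> U}. emeasure M U)) \<and>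
     (\<forall>U. open U \<longrightarrow> emeasure M U = (SUP K\<in>{K. compact K \<and> K \<subseteq> U}. emeasure M K))"

definition msupp :: "'a::topological_space measure \<Rightarrow> 'a set" where
  "msupp M = - \<Union>{U. open U \<and> emeasure M U = 0}"

definition lower_semicontinuous_kernel :: "('a::topological_space \<Rightarrow> 'a \<Rightarrow> ennreal) \<Rightarrow> bool" where
  "lower_semicontinuous_kernel G \<longleftrightarrow> (\<forall>t. open {(x, y). t < G x y})"

definition quasi_symmetric :: "('a \<Rightarrow> 'a \<Rightarrow> ennreal) \<Rightarrow> bool" where
  "quasi_symmetric G \<longleftrightarrow>
     (\<exists>a::real. 0 < a \<and>
        (\<forall>x y. ennreal (inverse a) * G y x \<le> G x y \<and> G x y \<le> ennreal a * G y x))"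

definition potential :: "('a \<Rightarrow> 'a \<Rightarrow> ennreal) \<Rightarrow> 'a measure \<Rightarrow> 'a \<Rightarrow> ennreal" where
  "potential G \<nu> x = (\<integral>\<^sup>+ y. G x y \<partial>\<nu>)"

definition weak_maximum_principle :: "('a::topological_space \<Rightarrow> 'a \<Rightarrow> ennreal) \<Rightarrow> bool" where
  "weak_maximum_principle G \<longleftrightarrow>
     (\<exists>h::real. 1 \<le> h \<and>
        (\<forall>\<nu>. radon_measure \<nu> \<longrightarrow> (\<forall>M::real. 0 < M \<longrightarrow>
           (SUP x\<in>msupp \<nu>. potential G \<nu> x) \<le> ennreal M \<longrightarrow>
           (SUP x. potential G \<nu> x) \<le> ennreal (h * M))))"

(* The potential of f d\<sigma> for nonnegative f. *)
definition wpotential ::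
    "('a \<Rightarrow> 'a \<Rightarrow> ennreal) \<Rightarrow> 'a measure \<Rightarrow> ('a \<Rightarrow> ennreal) \<Rightarrow> 'a \<Rightarrow> ennreal" where
  "wpotential G \<sigma> f x = (\<integral>\<^sup>+ y. G x y * f y \<partial>\<sigma>)"

(* The potential of f d\<sigma> for real-valued f, as the potential of the positive part minus
   that of the negative part (ennreal maps negative reals to 0).  On ereal,
   \<infinity> - \<infinity> = \<infinity>: a point where the integral is undefined counts as a point where the
   potential is infinite. *)
definition spotential ::
    "('a \<Rightarrow> 'a \<Rightarrow> ennreal) \<Rightarrow> 'a measure \<Rightarrow> ('a \<Rightarrow> real) \<Rightarrow> 'a \<Rightarrow> ereal" where
  "spotential G \<sigma> f x =
     enn2ereal (wpotential G \<sigma> (\<lambda>y. ennreal (f y)) x) -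
     enn2ereal (wpotential G \<sigma> (\<lambda>y. ennreal (- f y)) x)"

(* The L^r (quasi-)norm of a function, in terms of its modulus g. *)
definition Lnorm :: "'a measure \<Rightarrow> real \<Rightarrow> ('a \<Rightarrow> ennreal) \<Rightarrow> ennreal" where
  "Lnorm \<sigma> r g = (\<integral>\<^sup>+ x. g x epowr r \<partial>\<sigma>) epowr (1 / r)"

definition in_Lp :: "'a measure \<Rightarrow> real \<Rightarrow> ('a \<Rightarrow> real) \<Rightarrow> bool" where
  "in_Lp \<sigma> p f \<longleftrightarrow> f \<in> borel_measurable \<sigma> \<and> Lnorm \<sigma> p (\<lambda>x. ennreal \<bar>f x\<bar>) < \<infinity>"

definition in_Lp_nonneg :: "'a measure \<Rightarrow> real \<Rightarrow> ('a \<Rightarrow> ennreal) \<Rightarrow> bool" where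
  "in_Lp_nonneg \<sigma> r u \<longleftrightarrow> u \<in> borel_measurable \<sigma> \<and> Lnorm \<sigma> r u < \<infinity>"

definition weighted_norm_inequality ::
    "('a \<Rightarrow> 'a \<Rightarrow> ennreal) \<Rightarrow> 'a measure \<Rightarrow> real \<Rightarrow> real \<Rightarrow> bool" where
  "weighted_norm_inequality G \<sigma> p r \<longleftrightarrow>
     (\<exists>C::real. 0 < C \<and>
        (\<forall>f. in_Lp \<sigma> p f \<longrightarrow>
           Lnorm \<sigma> r (\<lambda>x. e2ennreal \<bar>spotential G \<sigma> f x\<bar>)
             \<le> ennreal C * Lnorm \<sigma> p (\<lambda>x. ennreal \<bar>f x\<bar>)))"

definition positive_supersolution ::
    "('a \<Rightarrow> 'a \<Rightarrow> ennreal) \<Rightarrow> 'a measure \<Rightarrow> real \<Rightarrow> ('a \<Rightarrow> ennreal) \<Rightarrow> bool" where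
  "positive_supersolution G \<sigma> q u \<longleftrightarrow>
     (AE x in \<sigma>. wpotential G \<sigma> (\<lambda>y. u y epowr q) x \<le> u x \<and> 0 < u x \<and> u x < \<infinity>)"

definition positive_solution ::
    "('a \<Rightarrow> 'a \<Rightarrow> ennreal) \<Rightarrow> 'a measure \<Rightarrow> real \<Rightarrow> ('a \<Rightarrow> ennreal) \<Rightarrow> bool" where
  "positive_solution G \<sigma> q u \<longleftrightarrow>
     (AE x in \<sigma>. u x = wpotential G \<sigma> (\<lambda>y. u y epowr q) x \<and> 0 < u x \<and> u x < \<infinity>)"

end

theory Submission
  imports Defs
begin

text \<open>
  Write \<open>T f\<close> for the potential of \<open>f d\<sigma>\<close> and \<open>A = T 1\<close> for the potential of \<open>\<sigma>\<close>. Once \<open>\<sigma>\<close> is known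
  to be \<open>\<sigma>\<close>-finite, two consequences of the hypotheses on \<open>G\<close> carry the whole argument.

  \<^item> Quasi-symmetry gives \<open>\<integral> g (T f) d\<sigma> \<le> a \<integral> f (T g) d\<sigma>\<close> (\<open>T_swap\<close>). This is Tonelli's theorem, but
    \<open>G\<close> is only Borel on the product space and need not be measurable for the product
    \<open>\<sigma>\<close>-algebra; lower semicontinuity and inner regularity allow one to approximate \<open>G\<close> from below
    by finite suprema of functions \<open>indicator U x * g y\<close> (\<open>potential_tonelli_le\<close>).
  \<^item> The weak maximum principle gives \<open>(T f)\<^sup>s \<le> \<kappa> T (f (T f)\<^sup>s\<^sup>-\<^sup>1)\<close> for \<open>s > 1\<close> (\<open>T_power_le\<close>), just as for
    integration on a half-line.

  Sufficiency of the integrability of \<open>A\<close>: the operator \<open>f \<mapsto> T f / A\<close> is bounded on \<open>L\<^sup>p\<close>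
  (\<open>T_quotient_bound\<close>). By duality this is a bound for \<open>g \<mapsto> T (g / A)\<close> on the conjugate space,
  and there the two facts give
  \<open>\<integral> (T (g / A))\<^sup>s \<le> \<kappa> a \<integral> (T (g / A))\<^sup>s\<^sup>-\<^sup>1 (g / A) A\<close>, which closes by Young's inequality. Then
  \<open>T f = A (T f / A)\<close> and Young's inequality once more yield
  \<open>\<integral> (T f)\<^sup>r \<le> D + \<epsilon> \<integral> f\<^sup>p\<close> for every \<open>\<epsilon> > 0\<close> (\<open>T_power_integral_le\<close>), where \<open>D\<close> depends on \<open>\<epsilon>\<close> and on
  \<open>\<integral> A\<^sup>p\<^sup>r\<^sup>/\<^sup>(\<^sup>p\<^sup>-\<^sup>r\<^sup>)\<close>. By homogeneity this is the norm inequality.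

  Necessity: test the inequality on a power of \<open>T (indicator F)\<close>, for sets \<open>F\<close> on which this potential
  is bounded, and use the power estimate from below.

  For the equation \<open>u = T (u\<^sup>q)\<close>, the power estimate shows that \<open>c A\<^sup>s\<close> with \<open>s = 1 / (1 - q)\<close> is a subsolution
  for a suitable \<open>c\<close>, and the same \<open>c A\<^sup>s\<close> is a lower bound for every supersolution, so that a supersolution in \<open>L\<^sup>r\<close>
  forces \<open>A\<^sup>s \<in> L\<^sup>r\<close>. Conversely, iterating \<open>u \<mapsto> T (u\<^sup>q)\<close> from the subsolution gives an increasing
  sequence, bounded in \<open>L\<^sup>r\<close> by the estimate with \<open>\<epsilon> = 1 / 2\<close>, whose limit is a solution.

  All absorption arguments need quantities that are finite beforehand; they take place on the sets
  of \<open>good_exhaustion\<close>.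
\<close>

section \<open>Powers of extended nonnegative reals\<close>

lemma zero_epowr [simp]: "0 epowr s = 0"
  by (simp add: epowr_def)

lemma top_epowr [simp]: "\<infinity> epowr s = \<infinity>" "top epowr s = top"
  by (simp_all add: epowr_def)

lemma ennreal_epowr: "0 \<le> x \<Longrightarrow> ennreal x epowr s = ennreal (x powr s)"
  by (simp add: epowr_def)

lemma epowr_one [simp]: "x epowr 1 = x"
  by (cases x) (auto simp: ennreal_epowr)

lemma one_epowr [simp]: "1 epowr s = 1"
  using ennreal_epowr[of 1 s] by simp

lemma epowr_mono: "x \<le> y \<Longrightarrow> 0 < s \<Longrightarrow> x epowr s \<le> y epowr s"
  by (cases x; cases y) (auto simp: ennreal_epowr top_unique powr_mono2)

lemma epowr_epowr: "0 < s \<Longrightarrow> 0 < t \<Longrightarrow> (x epowr s) epowr t = x epowr (s * t)"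
  by (cases x) (auto simp: ennreal_epowr powr_powr)

lemma epowr_add: "0 < s \<Longrightarrow> 0 < t \<Longrightarrow> x epowr (s + t) = x epowr s * x epowr t"
  by (cases x) (auto simp: ennreal_epowr powr_add ennreal_mult)

lemma epowr_mult: "0 < s \<Longrightarrow> (x * y) epowr s = x epowr s * y epowr s"
proof (cases "x = 0 \<or> y = 0")
  case False
  assume "0 < s"
  then show ?thesis using False
    by (cases x; cases y)
       (auto simp: ennreal_epowr powr_mult ennreal_mult'[symmetric] ennreal_top_mult ennreal_mult_top)
qed auto

lemma epowr_inverse_cancel: "0 < s \<Longrightarrow> (x epowr s) epowr (1 / s) = x"
  "0 < s \<Longrightarrow> (x epowr (1 / s)) epowr s = x"
  by (simp_all add: epowr_epowr)

lemma epowr_le_iff: "0 < s \<Longrightarrow> x epowr s \<le> y \<longleftrightarrow> x \<le> y epowr (1 / s)"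
  using epowr_mono[of "x epowr s" y "1 / s"] epowr_mono[of x "y epowr (1 / s)" s]
  by (auto simp: epowr_inverse_cancel)

lemma epowr_SUP: 
  assumes "0 < s"
  shows "(SUP i\<in>I. f i) epowr s = (SUP i\<in>I. f i epowr s)"
proof (rule antisym)
  show "(SUP i\<in>I. f i) epowr s \<le> (SUP i\<in>I. f i epowr s)"
    unfolding epowr_le_iff[OF assms]
    by (rule SUP_least) (auto simp: epowr_le_iff[OF assms, symmetric] intro: SUP_upper)
  show "(SUP i\<in>I. f i epowr s) \<le> (SUP i\<in>I. f i) epowr s"
    by (intro SUP_least epowr_mono SUP_upper assms)
qed

lemma epowr_eq_0_iff [simp]: "0 < s \<Longrightarrow> x epowr s = 0 \<longleftrightarrow> x = 0"
  by (cases x) (auto simp: ennreal_epowr)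

lemma epowr_pos_iff [simp]: "0 < s \<Longrightarrow> 0 < x epowr s \<longleftrightarrow> 0 < x"
  using epowr_eq_0_iff[of s x] by (metis not_gr_zero)

lemma epowr_eq_top_iff [simp]: "0 < s \<Longrightarrow> x epowr s = top \<longleftrightarrow> x = top"
  by (cases x) (auto simp: ennreal_epowr)

lemma epowr_less_top_iff [simp]: "0 < s \<Longrightarrow> x epowr s < top \<longleftrightarrow> x < top"
  by (cases x) (auto simp: ennreal_epowr)

lemma epowr_indicator: "0 < s \<Longrightarrow> (indicator F x * y) epowr s = indicator F x * y epowr s"
  by (auto simp: indicator_def)

lemma borel_measurable_epowr [measurable (raw)]:
  assumes [measurable]: "f \<in> borel_measurable M"
  shows "(\<lambda>x. f x epowr s) \<in> borel_measurable M"
  unfolding epowr_def by measurable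

text \<open>
  A crude form of Young's inequality. The second term may carry any constant, so it suffices to
  split according to whether \<open>y \<le> \<epsilon> x\<^sup>P\<^sup>-\<^sup>1\<close>: one of the two terms alone dominates the product.
\<close>

lemma young_epsilon:
  fixes P \<epsilon> :: real
  assumes "1 < P" "0 < \<epsilon>"
  obtains C :: real where "0 < C"
    "\<And>x y :: ennreal. x * y \<le> ennreal \<epsilon> * x epowr P + ennreal C * y epowr (P / (P - 1))"
proof
  define C where "C = (1 / \<epsilon>) powr (1 / (P - 1))"
  show "0 < C" using assms by (simp add: C_def)
  fix x y :: ennreal
  show "x * y \<le> ennreal \<epsilon> * x epowr P + ennreal C * y epowr (P / (P - 1))"
  proof (cases "y \<le> ennreal \<epsilon> * x epowr (P - 1)")
    case True
    have "x * y \<le> x epowr 1 * (ennreal \<epsilon> * x epowr (P - 1))"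
      using True by (simp add: mult_left_mono)
    also have "\<dots> = ennreal \<epsilon> * x epowr P"
      using epowr_add[of 1 "P - 1" x] assms by (simp add: ac_simps)
    finally show ?thesis by (simp add: add_increasing2)
  next
    case False
    have e1: "ennreal (1 / \<epsilon>) * ennreal \<epsilon> = 1"
      using assms by (simp add: ennreal_mult'[symmetric])
    have "ennreal \<epsilon> * x epowr (P - 1) \<le> y" using False by simp
    then have "ennreal (1 / \<epsilon>) * (ennreal \<epsilon> * x epowr (P - 1)) \<le> ennreal (1 / \<epsilon>) * y"
      by (rule mult_left_mono) simp
    then have "x epowr (P - 1) \<le> ennreal (1 / \<epsilon>) * y"
      using e1 by (simp add: mult.assoc[symmetric])
    then have "x \<le> (ennreal (1 / \<epsilon>) * y) epowr (1 / (P - 1))"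
      using assms by (simp add: epowr_le_iff)
    also have "\<dots> = ennreal C * y epowr (1 / (P - 1))"
      using assms by (simp add: epowr_mult ennreal_epowr C_def)
    finally have "x * y \<le> ennreal C * y epowr (1 / (P - 1)) * y epowr 1"
      by (simp add: mult_right_mono)
    also have "\<dots> = ennreal C * y epowr (P / (P - 1))"
      using epowr_add[of "1 / (P - 1)" 1 y] assms by (simp add: field_simps ac_simps)
    finally show ?thesis by (simp add: add_increasing)
  qed
qed

lemma absorb_half:
  fixes X Y :: ennreal
  assumes "X \<le> Y + ennreal (1 / 2) * X" "X < top"
  shows "X \<le> 2 * Y"
proof (cases Y)
  case (real y)
  obtain x where x: "X = ennreal x" "0 \<le> x" using assms(2) by (cases X) auto
  have "ennreal (1 / 2) * X = ennreal (x / 2)"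
    unfolding x by (subst ennreal_mult[symmetric]) (use x in auto)
  then have "ennreal x \<le> ennreal (y + x / 2)"
    using assms(1) real x by (simp add: ennreal_plus)
  then have "x \<le> y + x / 2" using real x by (subst (asm) ennreal_le_iff) auto
  then have "x \<le> 2 * y" by simp
  then have "ennreal x \<le> ennreal (2 * y)" by (rule ennreal_leI)
  also have "\<dots> = 2 * ennreal y" using real by (simp add: ennreal_mult)
  finally show ?thesis using real x by simp
qed (simp add: ennreal_mult_top)

lemma ennreal_mult_divide_cancel: "0 < c \<Longrightarrow> c < top \<Longrightarrow> c * (x / c) = (x :: ennreal)"
  by (simp add: ennreal_times_divide mult.commute[of c] ennreal_mult_divide_eq less_top[symmetric])

lemma ennreal_divide_mult_le: "x / c * c \<le> (x :: ennreal)"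
proof (cases "c = 0 \<or> c = top")
  case False
  then show ?thesis
    by (simp add: ennreal_divide_times less_top)
qed auto

lemma ex_of_nat_ge:
  fixes x :: ennreal assumes "x < top" obtains n :: nat where "x \<le> of_nat n"
proof -
  obtain r where r: "x = ennreal r" "0 \<le> r" using assms by (cases x) auto
  obtain n :: nat where "r \<le> n" using real_arch_simple by blast
  then show ?thesis using that[of n] r by (simp add: ennreal_of_nat_eq_real_of_nat ennreal_leI)
qed

lemma ex_of_nat_mult_ge_one:
  fixes x :: ennreal assumes "0 < x" obtains n :: nat where "1 \<le> of_nat n * x"
proof (cases x)
  case (real r)
  then have "0 < r" using assms by simp
  obtain n :: nat where "1 / r \<le> n" using real_arch_simple by blast
  then have "1 \<le> real n * r" using \<open>0 < r\<close> by (simp add: field_simps)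
  then have "ennreal 1 \<le> ennreal (real n * r)" by (rule ennreal_leI)
  then show ?thesis using that[of n] real by (simp add: ennreal_mult ennreal_of_nat_eq_real_of_nat)
qed (use that[of 1] in simp)

section \<open>Radon measures\<close>

lemma radon_measureD:
  assumes "radon_measure \<sigma>"
  shows radon_sets [simp]: "sets \<sigma> = sets borel"
    and radon_locally_finite: "\<exists>U. open U \<and> x \<in> U \<and> emeasure \<sigma> U < \<infinity>"
    and radon_outer_regular: "A \<in> sets borel \<Longrightarrow>
           (INF U\<in>{U. open U \<and> A \<subseteq> U}. emeasure \<sigma> U) = emeasure \<sigma> A"
    and radon_inner_regular_open: "open U \<Longrightarrow>
           (SUP K\<in>{K. compact K \<and> K \<subseteq> U}. emeasure \<sigma> K) = emeasure \<sigma> U"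
proof -
  note D = iffD1[OF radon_measure_def assms]
  show "sets \<sigma> = sets borel" by (rule conjunct1[OF D])
  note D = conjunct2[OF D]
  show "\<exists>U. open U \<and> x \<in> U \<and> emeasure \<sigma> U < \<infinity>" by (rule spec[OF conjunct1[OF D]])
  note D = conjunct2[OF D]
  show "A \<in> sets borel \<Longrightarrow> (INF U\<in>{U. open U \<and> A \<subseteq> U}. emeasure \<sigma> U) = emeasure \<sigma> A"
    by (rule sym, rule bspec[OF conjunct1[OF D]])
  show "open U \<Longrightarrow> (SUP K\<in>{K. compact K \<and> K \<subseteq> U}. emeasure \<sigma> K) = emeasure \<sigma> U"
    by (rule sym, rule mp[OF spec[OF conjunct2[OF D]]])
qed

lemma radon_space [simp]: "radon_measure \<sigma> \<Longrightarrow> space \<sigma> = UNIV"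
  using sets_eq_imp_space_eq[of \<sigma> borel] by simp

lemma radon_measurable [simp]:
  "radon_measure \<sigma> \<Longrightarrow> borel_measurable \<sigma> = borel_measurable borel"
  using measurable_cong_sets[of \<sigma> borel borel borel] by simp

lemma radon_compact_finite:
  assumes "radon_measure \<sigma>" "compact K"
  shows "emeasure \<sigma> K < \<infinity>"
proof -
  obtain U where U: "\<And>x. open (U x)" "\<And>x. x \<in> U x" "\<And>x. emeasure \<sigma> (U x) < \<infinity>"
    using radon_locally_finite[OF assms(1)] by metis
  obtain D where D: "D \<subseteq> K" "finite D" "K \<subseteq> (\<Union>x\<in>D. U x)"
    using compactE_image[OF assms(2), of K U] U by blast
  have "emeasure \<sigma> K \<le> emeasure \<sigma> (\<Union>x\<in>D. U x)"
    using D U assms by (intro emeasure_mono) (auto intro!: borel_open open_UN)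
  also have "\<dots> \<le> (\<Sum>x\<in>D. emeasure \<sigma> (U x))"
    using D U assms by (intro emeasure_subadditive_finite) auto
  also have "\<dots> < \<infinity>" using U(3) by (simp add: D less_top)
  finally show ?thesis .
qed

lemma radon_outer:
  assumes "radon_measure \<sigma>" "E \<in> sets borel" "emeasure \<sigma> E < \<infinity>" "0 < e"
  obtains U where "open U" "E \<subseteq> U" "emeasure \<sigma> U \<le> emeasure \<sigma> E + e" "emeasure \<sigma> (U - E) \<le> e"
proof (cases "e = \<infinity>")
  case True
  then show ?thesis using that[of UNIV] by auto
next
  case False
  have "(INF U\<in>{U. open U \<and> E \<subseteq> U}. emeasure \<sigma> U) = emeasure \<sigma> E"
    by (rule radon_outer_regular[OF assms(1,2)])
  moreover have "emeasure \<sigma> E < emeasure \<sigma> E + e"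
    using assms ennreal_add_left_cancel_less[of "emeasure \<sigma> E" 0 e] by simp
  ultimately have "(INF U\<in>{U. open U \<and> E \<subseteq> U}. emeasure \<sigma> U) < emeasure \<sigma> E + e" by simp
  then obtain U where U: "open U" "E \<subseteq> U" "emeasure \<sigma> U < emeasure \<sigma> E + e"
    unfolding INF_less_iff by auto
  have "emeasure \<sigma> U = emeasure \<sigma> E + emeasure \<sigma> (U - E)"
    using U assms by (subst plus_emeasure) (auto simp: Un_absorb1)
  with U(3) assms(3) have "emeasure \<sigma> (U - E) \<le> e"
    by (simp add: ennreal_add_left_cancel_less less_imp_le)
  with U show ?thesis using that[of U] by auto
qed

text \<open>
  Radon measures are only required to be inner regular on open sets; for a Borel set of finite
  measure, inner regularity follows by cutting an outer neighbourhood of the complementary part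
  out of a compact set.
\<close>

lemma radon_inner_finite:
  fixes \<sigma> :: "'a::t2_space measure"
  assumes R: "radon_measure \<sigma>" and E: "E \<in> sets borel" "emeasure \<sigma> E < \<infinity>" and e: "0 < e"
  obtains L where "compact L" "L \<subseteq> E" "emeasure \<sigma> (E - L) \<le> e"
proof (cases "e = \<infinity>")
  case True
  then show ?thesis using that[of "{}"] by auto
next
  case False
  obtain e' where e': "e = ennreal e'" "0 < e'" using e False by (cases e) auto
  define d where "d = ennreal (e' / 2)"
  have d: "0 < d" "d < \<infinity>" "d + d = e"
    using e' by (auto simp: d_def simp flip: ennreal_plus)
  obtain U where U: "open U" "E \<subseteq> U" "emeasure \<sigma> U \<le> emeasure \<sigma> E + d"
    using radon_outer[OF R E d(1)] by metis
  have Ufin: "emeasure \<sigma> U < \<infinity>" 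
    using order_le_less_trans[OF U(3)] E(2) d(2) by simp
  have "(SUP K\<in>{K. compact K \<and> K \<subseteq> U}. emeasure \<sigma> K) = emeasure \<sigma> U"
    by (rule radon_inner_regular_open[OF R U(1)])
  then obtain K where K: "compact K" "K \<subseteq> U" "emeasure \<sigma> U \<le> emeasure \<sigma> K + d"
  proof (cases "emeasure \<sigma> U = 0")
    case True then show ?thesis using that[of "{}"] by auto
  next
    case False
    assume S: "(SUP K\<in>{K. compact K \<and> K \<subseteq> U}. emeasure \<sigma> K) = emeasure \<sigma> U"
    have "emeasure \<sigma> U - d < emeasure \<sigma> U"
      using Ufin d False by (intro ennreal_between) (auto simp: zero_less_iff_neq_zero)
    then obtain K where "compact K" "K \<subseteq> U" "emeasure \<sigma> U - d < emeasure \<sigma> K"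
      unfolding S[symmetric] less_SUP_iff by auto
    then have "emeasure \<sigma> U \<le> emeasure \<sigma> K + d"
      using less_imp_le[of "emeasure \<sigma> U - d" "emeasure \<sigma> K"]
      by (simp add: ennreal_minus_le_iff add.commute)
    then show ?thesis using that[of K] \<open>compact K\<close> \<open>K \<subseteq> U\<close> by simp
  qed
  have K0: "closed K" "K \<in> sets borel" using K by (auto simp: compact_imp_closed)
  have "emeasure \<sigma> U = emeasure \<sigma> K + emeasure \<sigma> (U - K)"
    using K U R K0 by (subst plus_emeasure) (auto simp: Un_absorb1)
  with K(3) have UK: "emeasure \<sigma> (U - K) \<le> d"
    using radon_compact_finite[OF R K(1)] by (auto simp: ennreal_add_left_cancel_le)
  have "emeasure \<sigma> (U - E) \<le> emeasure \<sigma> U"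
    using R U by (intro emeasure_mono) auto
  then have "emeasure \<sigma> (U - E) < \<infinity>"
    using Ufin by (rule order_le_less_trans)
  then obtain V where V: "open V" "U - E \<subseteq> V" "emeasure \<sigma> (V - (U - E)) \<le> d"
    using radon_outer[OF R _ _ d(1), of "U - E"] E U by (metis borel_open sets.Diff)
  show ?thesis
  proof
    show "compact (K - V)" using K V by (simp add: compact_diff)
    show "K - V \<subseteq> E" using K V by auto
    have "emeasure \<sigma> (E - (K - V)) \<le> emeasure \<sigma> ((U - K) \<union> (V - (U - E)))"
      using U E R K0 V by (intro emeasure_mono) auto
    also have "\<dots> \<le> emeasure \<sigma> (U - K) + emeasure \<sigma> (V - (U - E))"
      using U E R K0 V by (intro emeasure_subadditive) auto
    also have "\<dots> \<le> e" using UK V(3) d(3) add_mono by metis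
    finally show "emeasure \<sigma> (E - (K - V)) \<le> e" .
  qed
qed

text \<open>
  The weak maximum principle speaks of Radon measures only; the following densities are the ones to
  which it is applied. Outer neighbourhoods may include the complement of the compact set \<open>K\<close>, which
  is open and has measure zero.
\<close>

lemma radon_density_bounded:
  fixes \<sigma> :: "'a::t2_space measure"
  assumes R: "radon_measure \<sigma>" and K: "compact K"
    and f [measurable]: "f \<in> borel_measurable borel"
    and bound: "\<And>x. f x \<le> ennreal b" and off: "\<And>x. x \<notin> K \<Longrightarrow> f x = 0"
  shows "radon_measure (density \<sigma> f)" "emeasure (density \<sigma> f) UNIV < \<infinity>"
proof -
  let ?\<nu> = "density \<sigma> f"
  define n where "n = max b 1"
  have n: "0 < n" "\<And>x. f x \<le> ennreal n"
    using order_trans[OF bound ennreal_leI[of b "max b 1"]] by (auto simp: n_def)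
  have K0 [measurable]: "K \<in> sets borel" using K by (simp add: borel_compact)
  have [simp]: "sets ?\<nu> = sets borel" using R by simp
  have le: "emeasure ?\<nu> E \<le> ennreal n * emeasure \<sigma> (E \<inter> K)" if [measurable]: "E \<in> sets borel" for E
  proof -
    have "emeasure ?\<nu> E = (\<integral>\<^sup>+ x. f x * indicator E x \<partial>\<sigma>)"
      using R by (subst emeasure_density) auto
    also have "\<dots> \<le> (\<integral>\<^sup>+ x. ennreal n * indicator (E \<inter> K) x \<partial>\<sigma>)"
      using n off by (intro nn_integral_mono) (auto simp: indicator_def)
    also have "\<dots> = ennreal n * emeasure \<sigma> (E \<inter> K)"
      using R by (subst nn_integral_cmult_indicator) auto
    finally show ?thesis .
  qed
  have Kfin: "emeasure \<sigma> K < \<infinity>" by (rule radon_compact_finite[OF R K])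
  have EK: "emeasure \<sigma> (E \<inter> K) < \<infinity>" if "E \<in> sets borel" for E
    using Kfin R that by (intro order_le_less_trans[OF emeasure_mono Kfin]) auto
  have "emeasure ?\<nu> UNIV \<le> ennreal n * emeasure \<sigma> K" using le[of UNIV] by simp
  also have "\<dots> < \<infinity>" using Kfin by (simp add: ennreal_mult_less_top)
  finally show fin: "emeasure ?\<nu> UNIV < \<infinity>" .
  \<comment> \<open>Changes of \<open>\<sigma>\<close>-measure at most \<open>e / n\<close> inside \<open>K\<close> cost at most \<open>e\<close> in the new measure.\<close>
  have small: "emeasure ?\<nu> E \<le> ennreal e"
    if "E \<in> sets borel" "E \<inter> K \<subseteq> F" "F \<in> sets borel" "emeasure \<sigma> F \<le> ennreal (e / n)" "0 < e" for E F e
  proof -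
    have "emeasure ?\<nu> E \<le> ennreal n * emeasure \<sigma> F"
      using that R by (intro order_trans[OF le] mult_left_mono emeasure_mono) auto
    also have "\<dots> \<le> ennreal n * ennreal (e / n)"
      using that by (intro mult_left_mono) auto
    also have "\<dots> = ennreal e"
      using n that by (subst ennreal_mult[symmetric]) auto
    finally show ?thesis .
  qed
  have outer: "emeasure ?\<nu> A = (INF U\<in>{U. open U \<and> A \<subseteq> U}. emeasure ?\<nu> U)"
    if A: "A \<in> sets borel" for A
  proof (rule antisym)
    show "emeasure ?\<nu> A \<le> (INF U\<in>{U. open U \<and> A \<subseteq> U}. emeasure ?\<nu> U)"
      using R by (intro INF_greatest emeasure_mono) auto
    show "(INF U\<in>{U. open U \<and> A \<subseteq> U}. emeasure ?\<nu> U) \<le> emeasure ?\<nu> A"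
    proof (rule ennreal_le_epsilon)
      fix e :: real assume "0 < e"
      then have "0 < ennreal (e / n)" using n by simp
      then obtain U where U: "open U" "A \<inter> K \<subseteq> U" "emeasure \<sigma> (U - A \<inter> K) \<le> ennreal (e / n)"
        using radon_outer[OF R _ EK[OF A], of "ennreal (e / n)"] A K0 by (metis sets.Int)
      let ?V = "U \<union> - K"
      have V: "open ?V" "A \<subseteq> ?V" using U K by (auto simp: compact_imp_closed open_Compl)
      have "(INF U\<in>{U. open U \<and> A \<subseteq> U}. emeasure ?\<nu> U) \<le> emeasure ?\<nu> (A \<union> (?V - A))"
        using V by (intro INF_lower) (auto simp: Un_absorb1)
      also have "\<dots> \<le> emeasure ?\<nu> A + emeasure ?\<nu> (?V - A)"
        using A V R by (intro emeasure_subadditive) auto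
      also have "\<dots> \<le> emeasure ?\<nu> A + ennreal e"
        using A V U \<open>0 < e\<close> by (intro add_left_mono small[of _ "U - A \<inter> K"]) auto
      finally show "(INF U\<in>{U. open U \<and> A \<subseteq> U}. emeasure ?\<nu> U) \<le> emeasure ?\<nu> A + ennreal e" .
    qed
  qed
  have inner: "emeasure ?\<nu> U = (SUP L\<in>{L. compact L \<and> L \<subseteq> U}. emeasure ?\<nu> L)"
    if U: "open U" for U
  proof (rule antisym)
    show "(SUP L\<in>{L. compact L \<and> L \<subseteq> U}. emeasure ?\<nu> L) \<le> emeasure ?\<nu> U"
      using U R by (intro SUP_least emeasure_mono) auto
    show "emeasure ?\<nu> U \<le> (SUP L\<in>{L. compact L \<and> L \<subseteq> U}. emeasure ?\<nu> L)"
    proof (rule ennreal_le_epsilon)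
      fix e :: real assume "0 < e"
      then have "0 < ennreal (e / n)" using n by simp
      then obtain L where L: "compact L" "L \<subseteq> U \<inter> K" "emeasure \<sigma> (U \<inter> K - L) \<le> ennreal (e / n)"
        using radon_inner_finite[OF R _ EK[of U], of "ennreal (e / n)"] U K0
        by (metis sets.Int borel_open)
      have L0: "L \<in> sets borel" using L by (simp add: borel_compact)
      have "emeasure ?\<nu> U = emeasure ?\<nu> (L \<union> (U - L))"
        using L by (intro arg_cong[where f = "emeasure ?\<nu>"]) auto
      also have "\<dots> \<le> emeasure ?\<nu> L + emeasure ?\<nu> (U - L)"
        using U L0 R by (intro emeasure_subadditive) auto
      also have "\<dots> \<le> (SUP L\<in>{L. compact L \<and> L \<subseteq> U}. emeasure ?\<nu> L) + ennreal e"
        using U L L0 \<open>0 < e\<close>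
        by (intro add_mono SUP_upper small[of _ "U \<inter> K - L"]) auto
      finally show "emeasure ?\<nu> U \<le> (SUP L\<in>{L. compact L \<and> L \<subseteq> U}. emeasure ?\<nu> L) + ennreal e" .
    qed
  qed
  have loc: "\<exists>U. open U \<and> x \<in> U \<and> emeasure ?\<nu> U < \<infinity>" for x
    using fin by (intro exI[of _ UNIV]) auto
  show "radon_measure ?\<nu>"
    unfolding radon_measure_def
    by (intro conjI allI ballI impI loc outer inner) (use R in simp_all)
qed

section \<open>Lower semicontinuous kernels and finite Radon measures\<close>

lemma lsc_imp_borel:
  fixes f :: "'a::topological_space \<Rightarrow> ennreal"
  assumes "\<And>t. open {x. t < f x}"
  shows "f \<in> borel_measurable borel"
  by (rule borel_measurableI_greater) (use assms in simp)

text \<open>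
  A simple function below \<open>f\<close> can be shrunk to one living on disjoint compact sets with values
  strictly below \<open>f\<close>. On compact sets, lower semicontinuity turns such strict inequalities into
  inequalities valid on neighbourhoods.
\<close>

lemma radon_compact_step:
  fixes \<nu> :: "'a::t2_space measure" and f :: "'a \<Rightarrow> ennreal"
  assumes R: "radon_measure \<nu>" and fin: "emeasure \<nu> UNIV < \<infinity>"
    and t: "t < (\<integral>\<^sup>+ x. f x \<partial>\<nu>)"
  obtains J :: "ennreal set" and c :: "ennreal \<Rightarrow> ennreal" and L :: "ennreal \<Rightarrow> 'a set" where
    "finite J" "\<forall>j\<in>J. compact (L j)" "\<forall>j\<in>J. \<forall>y\<in>L j. c j < f y"
    "disjoint_family_on L J" "t < (\<Sum>j\<in>J. c j * emeasure \<nu> (L j))"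
proof -
  obtain s where s: "simple_function \<nu> s" "s \<le> f" "\<And>x. s x < top" "t < integral\<^sup>S \<nu> s"
    using t unfolding nn_integral_def_finite less_SUP_iff by auto
  define E where "E v = s -` {v}" for v
  have E: "E v \<in> sets borel" "emeasure \<nu> (E v) < \<infinity>" for v
  proof -
    show E0: "E v \<in> sets borel" using simple_functionD(2)[OF s(1), of "{v}"] R by (simp add: E_def)
    show "emeasure \<nu> (E v) < \<infinity>"
      using E0 R by (intro order_le_less_trans[OF emeasure_mono fin]) auto
  qed
  have finJ: "finite (range s)" using simple_functionD(1)[OF s(1)] R by simp
  define J where "J = range s - {0}"
  have S: "integral\<^sup>S \<nu> s = (\<Sum>v\<in>J. v * emeasure \<nu> (E v))"
  proof -
    have "integral\<^sup>S \<nu> s = (\<Sum>v\<in>range s. v * emeasure \<nu> (E v))"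
      using R by (simp add: simple_integral_def E_def)
    also have "\<dots> = (\<Sum>v\<in>J. v * emeasure \<nu> (E v))"
      unfolding J_def by (rule sum.mono_neutral_right) (use finJ in auto)
    finally show ?thesis .
  qed
  have "integral\<^sup>S \<nu> s < \<infinity>"
    unfolding S using E finJ s(3) by (auto simp: J_def ennreal_mult_less_top less_top)
  then obtain S' where S': "integral\<^sup>S \<nu> s = ennreal S'" "0 \<le> S'" by (cases "integral\<^sup>S \<nu> s") auto
  obtain t' where t': "t = ennreal t'" "0 \<le> t'" "t' < S'" using s(4) S' by (cases t) (auto simp: ennreal_less_iff)
  define \<theta> where "\<theta> = (1 + t' / S') / 2"
  have \<theta>: "0 < \<theta>" "\<theta> < 1" using t' by (auto simp: \<theta>_def field_simps)
  have \<theta>2: "t' < \<theta> * \<theta> * S'"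
  proof -
    have "0 < (\<theta> - 1)\<^sup>2" using \<theta> by simp
    then have "2 * \<theta> - 1 < \<theta> * \<theta>" by (simp add: power2_eq_square algebra_simps)
    moreover have "\<theta> + \<theta> = 1 + t' / S'" unfolding \<theta>_def by (rule field_sum_of_halves)
    ultimately have "t' / S' < \<theta> * \<theta>" by simp
    then show ?thesis using t' by (simp add: field_simps)
  qed
  have "\<exists>L. compact L \<and> L \<subseteq> E v \<and> ennreal \<theta> * emeasure \<nu> (E v) \<le> emeasure \<nu> L" for v
  proof (cases "emeasure \<nu> (E v) = 0")
    case True
    then show ?thesis by (intro exI[of _ "{}"]) auto
  next
    case False
    obtain m where m: "emeasure \<nu> (E v) = ennreal m" "0 < m"
      using False E(2)[of v] by (cases "emeasure \<nu> (E v)") auto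
    have "0 < ennreal ((1 - \<theta>) * m)" using \<theta> m by simp
    then obtain L where L: "compact L" "L \<subseteq> E v" "emeasure \<nu> (E v - L) \<le> ennreal ((1 - \<theta>) * m)"
      using radon_inner_finite[OF R E] by metis
    have "emeasure \<nu> (E v) = emeasure \<nu> L + emeasure \<nu> (E v - L)"
      using L E R by (subst plus_emeasure) (auto simp: Un_absorb1 borel_compact)
    also have "\<dots> \<le> emeasure \<nu> L + ennreal ((1 - \<theta>) * m)" using L by (intro add_left_mono)
    finally have 1: "ennreal m \<le> emeasure \<nu> L + ennreal ((1 - \<theta>) * m)" using m by simp
    have "emeasure \<nu> L < \<infinity>" using radon_compact_finite[OF R L(1)] .
    then obtain l where l: "emeasure \<nu> L = ennreal l" "0 \<le> l" by (cases "emeasure \<nu> L") auto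
    have nn: "0 \<le> l + (1 - \<theta>) * m"
      using l m \<theta> by (intro add_nonneg_nonneg mult_nonneg_nonneg) auto
    have "ennreal m \<le> ennreal (l + (1 - \<theta>) * m)"
      using 1 l \<theta> m by (subst ennreal_plus) auto
    then have "\<theta> * m \<le> l" unfolding ennreal_le_iff[OF nn] by (simp add: algebra_simps)
    then show ?thesis using L m l \<theta> by (auto simp: ennreal_mult[symmetric] intro!: exI[of _ L])
  qed
  then obtain L where L: "\<And>v. compact (L v)" "\<And>v. L v \<subseteq> E v"
    "\<And>v. ennreal \<theta> * emeasure \<nu> (E v) \<le> emeasure \<nu> (L v)" by metis
  show ?thesis
  proof (rule that[of J L "\<lambda>v. ennreal \<theta> * v"])
    show "finite J" using finJ by (simp add: J_def)
    show "\<forall>j\<in>J. compact (L j)" using L(1) by blast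
    show "\<forall>j\<in>J. \<forall>y\<in>L j. ennreal \<theta> * j < f y"
    proof (intro ballI)
      fix j y assume j: "j \<in> J" "y \<in> L j"
      have y: "s y = j" using L(2)[of j] j by (auto simp: E_def)
      obtain x where x: "j = ennreal x" "0 < x"
        using s(3)[of y] j y by (cases j) (auto simp: J_def)
      have "ennreal \<theta> * j < j"
        unfolding x using x \<theta> by (simp add: ennreal_mult[symmetric] ennreal_less_iff)
      also have "\<dots> \<le> f y" using s(2) y by (auto simp: le_fun_def)
      finally show "ennreal \<theta> * j < f y" .
    qed
    show "disjoint_family_on L J"
      using L(2) unfolding disjoint_family_on_def E_def by blast
    have "t < ennreal (\<theta> * \<theta> * S')"
      using t' \<theta>2 by (simp add: ennreal_less_iff)
    also have "\<dots> = ennreal \<theta> * (ennreal \<theta> * (\<Sum>v\<in>J. v * emeasure \<nu> (E v)))"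
      using \<theta> S' S by (simp add: ennreal_mult mult.assoc)
    also have "\<dots> = (\<Sum>v\<in>J. (ennreal \<theta> * v) * (ennreal \<theta> * emeasure \<nu> (E v)))"
      by (simp add: sum_distrib_left ac_simps)
    also have "\<dots> \<le> (\<Sum>v\<in>J. ennreal \<theta> * v * emeasure \<nu> (L v))"
      by (intro sum_mono mult_left_mono L) auto
    finally show "t < (\<Sum>v\<in>J. ennreal \<theta> * v * emeasure \<nu> (L v))" .
  qed
qed

text \<open>
  The local form of lower semicontinuity of a potential: a lower bound at \<open>x\<^sub>0\<close> is witnessed by one
  function \<open>g\<close> that stays below \<open>G x\<close> for all \<open>x\<close> near \<open>x\<^sub>0\<close>. The product functions
  \<open>indicator U x * g y\<close> are what makes the iterated integrals below comparable, because \<open>G\<close> itself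
  need not be measurable for the product of the Borel \<open>\<sigma>\<close>-algebras.
\<close>

lemma potential_local_lower_bound:
  fixes \<nu> :: "'a::t2_space measure" and G :: "'a \<Rightarrow> 'a \<Rightarrow> ennreal"
  assumes R: "radon_measure \<nu>" "emeasure \<nu> UNIV < \<infinity>"
    and G: "lower_semicontinuous_kernel G" and t: "t < potential G \<nu> x\<^sub>0"
  obtains U g where "open U" "x\<^sub>0 \<in> U" "g \<in> borel_measurable borel"
    "\<forall>x\<in>U. \<forall>y. g y \<le> G x y" "t < (\<integral>\<^sup>+ y. g y \<partial>\<nu>)"
proof -
  obtain J :: "ennreal set" and c L where J: "finite J" "\<forall>j\<in>J. compact (L j)"
    "\<forall>j\<in>J. \<forall>y\<in>L j. c j < G x\<^sub>0 y"
    "disjoint_family_on L J" "t < (\<Sum>j\<in>J. c j * emeasure \<nu> (L j))"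
    by (rule radon_compact_step[OF R t[unfolded potential_def]]) (rule that)
  have "\<exists>U. open U \<and> x\<^sub>0 \<in> U \<and> U \<times> L j \<subseteq> {(x, y). c j < G x y}" if "j \<in> J" for j
  proof -
    have "open {(x, y). c j < G x y}" using G by (simp add: lower_semicontinuous_kernel_def)
    moreover have "{x\<^sub>0} \<times> L j \<subseteq> {(x, y). c j < G x y}" using J(3) that by auto
    ultimately show ?thesis
      using Elementary_Topology.tube_lemma[OF J(2)[rule_format, OF that]] by metis
  qed
  then obtain U where U: "\<And>j. j \<in> J \<Longrightarrow> open (U j)" "\<And>j. j \<in> J \<Longrightarrow> x\<^sub>0 \<in> U j"
    "\<And>j. j \<in> J \<Longrightarrow> U j \<times> L j \<subseteq> {(x, y). c j < G x y}" by metis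
  have Lb: "L j \<in> sets borel" if "j \<in> J" for j using J(2)[rule_format, OF that] by (simp add: borel_compact)
  show ?thesis
  proof (rule that[of "\<Inter>j\<in>J. U j" "\<lambda>y. \<Sum>j\<in>J. c j * indicator (L j) y"])
    show "open (\<Inter>j\<in>J. U j)" using J(1) U(1) by auto
    show "x\<^sub>0 \<in> (\<Inter>j\<in>J. U j)" using U(2) by auto
    show "(\<lambda>y. \<Sum>j\<in>J. c j * indicator (L j) y) \<in> borel_measurable borel" using Lb by measurable
    have "(\<Sum>j\<in>J. c j * indicator (L j) y) \<le> G x y" if x: "x \<in> (\<Inter>j\<in>J. U j)" for x y
    proof (cases "\<exists>j\<in>J. y \<in> L j")
      case True
      then obtain i where i: "i \<in> J" "y \<in> L i" by auto
      have "(\<Sum>j\<in>J. c j * indicator (L j) y) = (\<Sum>j\<in>{i}. c j * indicator (L j) y)"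
        using i J(1,4) by (intro sum.mono_neutral_right) (auto simp: disjoint_family_on_def indicator_def)
      also have "\<dots> \<le> G x y"
      proof -
        have "(x, y) \<in> {(x, y). c i < G x y}" using i U(3)[OF i(1)] x by blast
        then show ?thesis using i(2) by (simp add: less_imp_le)
      qed
      finally show ?thesis .
    next
      case False
      then have "(\<Sum>j\<in>J. c j * indicator (L j) y) = 0" by (auto simp: indicator_def)
      then show ?thesis by simp
    qed
    then show "\<forall>x\<in>\<Inter>j\<in>J. U j. \<forall>y. (\<Sum>j\<in>J. c j * indicator (L j) y) \<le> G x y" by blast
    have "(\<integral>\<^sup>+ y. (\<Sum>j\<in>J. c j * indicator (L j) y) \<partial>\<nu>) = (\<Sum>j\<in>J. c j * emeasure \<nu> (L j))"
      using Lb R by (subst nn_integral_sum) (auto simp: nn_integral_cmult_indicator)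
    then show "t < (\<integral>\<^sup>+ y. (\<Sum>j\<in>J. c j * indicator (L j) y) \<partial>\<nu>)" using J(5) by simp
  qed
qed

lemma potential_lsc:
  fixes \<nu> :: "'a::t2_space measure"
  assumes R: "radon_measure \<nu>" "emeasure \<nu> UNIV < \<infinity>" and G: "lower_semicontinuous_kernel G"
  shows "open {x. t < potential G \<nu> x}"
proof (subst open_subopen, intro ballI)
  fix x assume "x \<in> {x. t < potential G \<nu> x}"
  then have t: "t < potential G \<nu> x" by simp
  obtain U g where U: "open U" "x \<in> U" "g \<in> borel_measurable borel"
    "\<forall>x\<in>U. \<forall>y. g y \<le> G x y" "t < (\<integral>\<^sup>+ y. g y \<partial>\<nu>)"
    by (rule potential_local_lower_bound[OF R G t]) (rule that)
  have "t < potential G \<nu> z" if "z \<in> U" for z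
    unfolding potential_def using U(4) that by (intro order_less_le_trans[OF U(5) nn_integral_mono]) blast
  then show "\<exists>T. open T \<and> x \<in> T \<and> T \<subseteq> {x. t < potential G \<nu> x}"
    using U by blast
qed

lemma borel_measurable_kernel:
  assumes G: "lower_semicontinuous_kernel G"
  shows "G x \<in> borel_measurable borel"
proof (rule lsc_imp_borel)
  fix t
  have "open ((\<lambda>y. (x, y)) -` {(x, y). t < G x y})"
    using G unfolding lower_semicontinuous_kernel_def by (intro open_vimage continuous_intros; simp)
  then show "open {y. t < G x y}" by (simp add: vimage_def)
qed

lemma potential_product_minorant:
  fixes \<nu> :: "'a::t2_space measure" and G :: "'a \<Rightarrow> 'a \<Rightarrow> ennreal"
  assumes R: "radon_measure \<nu>" "emeasure \<nu> UNIV < \<infinity>"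
    and G: "lower_semicontinuous_kernel G" and L: "compact L" "\<And>x. x \<in> L \<Longrightarrow> t < potential G \<nu> x"
  obtains H where "case_prod H \<in> borel_measurable (borel \<Otimes>\<^sub>M borel)" "\<forall>x y. H x y \<le> G x y"
    "\<forall>x\<in>L. t < (\<integral>\<^sup>+ y. H x y \<partial>\<nu>)"
proof -
  have "\<exists>U g. open U \<and> x \<in> U \<and> g \<in> borel_measurable borel \<and> (\<forall>z\<in>U. \<forall>y. g y \<le> G z y)
          \<and> t < (\<integral>\<^sup>+ y. g y \<partial>\<nu>)" if "x \<in> L" for x
    by (rule potential_local_lower_bound[OF R G L(2)[OF that]]) metis
  then obtain U g where U: "\<And>x. x \<in> L \<Longrightarrow> open (U x)" "\<And>x. x \<in> L \<Longrightarrow> x \<in> U x"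
    "\<And>x. x \<in> L \<Longrightarrow> g x \<in> borel_measurable borel"
    "\<And>x z y. x \<in> L \<Longrightarrow> z \<in> U x \<Longrightarrow> g x y \<le> G z y"
    "\<And>x. x \<in> L \<Longrightarrow> t < (\<integral>\<^sup>+ y. g x y \<partial>\<nu>)" by metis
  obtain D where D: "D \<subseteq> L" "finite D" "L \<subseteq> (\<Union>x\<in>D. U x)"
    using compactE_image[OF L(1), of L U] U(1,2) by blast
  let ?H = "\<lambda>x y. SUP d\<in>D. indicator (U d) x * g d y"
  show ?thesis
  proof (rule that[of ?H])
    have [measurable]: "U d \<in> sets borel" "g d \<in> borel_measurable borel" if "d \<in> D" for d
      using that D(1) U(1,3) by auto
    show "case_prod ?H \<in> borel_measurable (borel \<Otimes>\<^sub>M borel)"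
      unfolding case_prod_beta using D(2) by (intro borel_measurable_SUP) (auto simp: countable_finite)
    show "\<forall>x y. ?H x y \<le> G x y"
      using D(1) U(4) by (intro allI SUP_least) (auto simp: indicator_def)
    show "\<forall>x\<in>L. t < (\<integral>\<^sup>+ y. ?H x y \<partial>\<nu>)"
    proof
      fix x assume "x \<in> L"
      then obtain d where d: "d \<in> D" "x \<in> U d" using D(3) by auto
      have "t < (\<integral>\<^sup>+ y. g d y \<partial>\<nu>)" using d D(1) U(5) by auto
      also have "\<dots> \<le> (\<integral>\<^sup>+ y. ?H x y \<partial>\<nu>)"
        using d by (intro nn_integral_mono SUP_upper2[OF d(1)]) auto
      finally show "t < (\<integral>\<^sup>+ y. ?H x y \<partial>\<nu>)" .
    qed
  qed
qed

text \<open>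
  One of the two iterated integrals is approximated from below by iterated integrals of minorants
  of \<open>G\<close> that are measurable for the product \<open>\<sigma>\<close>-algebra, to which Tonelli's theorem applies.
\<close>

lemma potential_tonelli_le:
  fixes \<mu> \<nu> :: "'a::t2_space measure" and G :: "'a \<Rightarrow> 'a \<Rightarrow> ennreal"
  assumes M: "radon_measure \<mu>" "emeasure \<mu> UNIV < \<infinity>"
    and N: "radon_measure \<nu>" "emeasure \<nu> UNIV < \<infinity>"
    and G: "lower_semicontinuous_kernel G"
  shows "(\<integral>\<^sup>+ x. potential G \<nu> x \<partial>\<mu>) \<le> (\<integral>\<^sup>+ y. (\<integral>\<^sup>+ x. G x y \<partial>\<mu>) \<partial>\<nu>)"
proof (rule leI, rule notI)
  let ?t = "\<integral>\<^sup>+ y. (\<integral>\<^sup>+ x. G x y \<partial>\<mu>) \<partial>\<nu>"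
  assume lt: "?t < (\<integral>\<^sup>+ x. potential G \<nu> x \<partial>\<mu>)"
  obtain J :: "ennreal set" and c L where J: "finite J" "\<forall>j\<in>J. compact (L j)"
    "\<forall>j\<in>J. \<forall>y\<in>L j. c j < potential G \<nu> y"
    "disjoint_family_on L J" "?t < (\<Sum>j\<in>J. c j * emeasure \<mu> (L j))"
    by (rule radon_compact_step[OF M lt]) (rule that)
  have "\<exists>H. case_prod H \<in> borel_measurable (borel \<Otimes>\<^sub>M borel) \<and> (\<forall>x y. H x y \<le> G x y) \<and>
          (\<forall>x\<in>L j. c j < (\<integral>\<^sup>+ y. H x y \<partial>\<nu>))" if "j \<in> J" for j
    by (rule potential_product_minorant[OF N G J(2)[rule_format, OF that] J(3)[rule_format, OF that]]) metis+
  then obtain H where H: "\<And>j. j \<in> J \<Longrightarrow> case_prod (H j) \<in> borel_measurable (borel \<Otimes>\<^sub>M borel)"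
    "\<And>j x y. j \<in> J \<Longrightarrow> H j x y \<le> G x y"
    "\<And>j x. j \<in> J \<Longrightarrow> x \<in> L j \<Longrightarrow> c j < (\<integral>\<^sup>+ y. H j x y \<partial>\<nu>)" by metis
  have Lb: "L j \<in> sets borel" if "j \<in> J" for j using J(2)[rule_format, OF that] by (simp add: borel_compact)
  let ?H = "\<lambda>x y. SUP j\<in>J. H j x y"
  interpret M: finite_measure \<mu> using M by (intro finite_measureI) auto
  interpret N: finite_measure \<nu> using N by (intro finite_measureI) auto
  interpret NM: pair_sigma_finite \<nu> \<mu> ..
  interpret MN: pair_sigma_finite \<mu> \<nu> ..
  have sets: "sets (\<mu> \<Otimes>\<^sub>M \<nu>) = sets (borel \<Otimes>\<^sub>M borel)"
    using M N by (intro sets_pair_measure_cong) auto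
  have mH: "case_prod ?H \<in> borel_measurable (\<mu> \<Otimes>\<^sub>M \<nu>)"
    unfolding measurable_cong_sets[OF sets refl]
    unfolding case_prod_beta using J(1) H(1)
    by (intro borel_measurable_SUP) (auto simp: countable_finite case_prod_beta)
  have le: "(\<Sum>j\<in>J. c j * indicator (L j) x) \<le> (\<integral>\<^sup>+ y. ?H x y \<partial>\<nu>)" for x
  proof (cases "\<exists>j\<in>J. x \<in> L j")
    case True
    then obtain i where i: "i \<in> J" "x \<in> L i" by auto
    have "(\<Sum>j\<in>J. c j * indicator (L j) x) = (\<Sum>j\<in>{i}. c j * indicator (L j) x)"
      using i J(1,4) by (intro sum.mono_neutral_right) (auto simp: disjoint_family_on_def indicator_def)
    also have "\<dots> \<le> (\<integral>\<^sup>+ y. H i x y \<partial>\<nu>)" using i H(3)[OF i] by (simp add: less_imp_le)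
    also have "\<dots> \<le> (\<integral>\<^sup>+ y. ?H x y \<partial>\<nu>)"
      using i by (intro nn_integral_mono SUP_upper)
    finally show ?thesis .
  next
    case False
    then have "(\<Sum>j\<in>J. c j * indicator (L j) x) = 0" by (auto simp: indicator_def)
    then show ?thesis by simp
  qed
  have "(\<Sum>j\<in>J. c j * emeasure \<mu> (L j)) = (\<integral>\<^sup>+ x. (\<Sum>j\<in>J. c j * indicator (L j) x) \<partial>\<mu>)"
    using Lb M by (subst nn_integral_sum) (auto simp: nn_integral_cmult_indicator)
  also have "\<dots> \<le> (\<integral>\<^sup>+ x. (\<integral>\<^sup>+ y. ?H x y \<partial>\<nu>) \<partial>\<mu>)" by (intro nn_integral_mono le)
  also have "\<dots> = (\<integral>\<^sup>+ y. (\<integral>\<^sup>+ x. ?H x y \<partial>\<mu>) \<partial>\<nu>)" by (rule MN.Fubini'[OF mH, symmetric])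
  also have "\<dots> \<le> ?t" using H(2) by (intro nn_integral_mono SUP_least)
  finally show False using J(5) by simp
qed

section \<open>The potential operator of a \<open>\<sigma>\<close>-finite Radon measure\<close>

lemma sigma_finite_if_positive_integrable:
  assumes v [measurable]: "v \<in> borel_measurable M" and pos: "AE x in M. 0 < v x"
    and fin: "(\<integral>\<^sup>+ x. v x \<partial>M) < \<infinity>"
  shows "sigma_finite_measure M"
proof
  let ?E = "\<lambda>n. {x \<in> space M. 1 \<le> of_nat n * v x}"
  let ?Z = "{x \<in> space M. v x = 0}"
  have Z: "emeasure M ?Z = 0"
    by (rule AE_iff_measurable[THEN iffD1, OF _ _ pos]) auto
  have E: "emeasure M (?E n) \<noteq> \<infinity>" for n
  proof -
    have "emeasure M (?E n) \<le> of_nat n * (\<integral>\<^sup>+ x. v x \<partial>M)"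
      using nn_integral_Markov_inequality[of v "space M" M "of_nat n"]
      by (simp add: Int_def cong: nn_integral_cong)
    also have "\<dots> < \<infinity>" using fin by (simp add: ennreal_mult_less_top of_nat_less_top)
    finally show ?thesis by simp
  qed
  have cover: "x \<in> (\<Union>n. ?E n) \<union> ?Z" if x: "x \<in> space M" for x
  proof (cases "v x = 0")
    case False
    then have "0 < v x" by (simp add: zero_less_iff_neq_zero)
    then obtain n :: nat where "1 \<le> of_nat n * v x" by (rule ex_of_nat_mult_ge_one)
    then show ?thesis using x by auto
  qed (use x in auto)
  show "\<exists>A. countable A \<and> A \<subseteq> sets M \<and> \<Union> A = space M \<and> (\<forall>a\<in>A. emeasure M a \<noteq> \<infinity>)"
  proof (intro exI[of _ "insert ?Z (range ?E)"] conjI)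
    show "\<Union> (insert ?Z (range ?E)) = space M" using cover by auto
    show "\<forall>a\<in>insert ?Z (range ?E). emeasure M a \<noteq> \<infinity>" using E Z by auto
  qed auto
qed

text \<open>
  Borel sets of finite measure are inner regular, so countably many compact subsets exhaust each
  of them up to a null set.
\<close>

lemma radon_sigma_finite_exhaustion:
  fixes \<sigma> :: "'a::t2_space measure"
  assumes R: "radon_measure \<sigma>" and "sigma_finite_measure \<sigma>"
  obtains K :: "nat \<Rightarrow> 'a set" where "\<forall>n. compact (K n)" "incseq K" "AE x in \<sigma>. \<exists>n. x \<in> K n"
proof -
  interpret sigma_finite_measure \<sigma> by fact
  obtain E :: "nat \<Rightarrow> 'a set" where E: "range E \<subseteq> sets \<sigma>" "(\<Union>i. E i) = space \<sigma>"
    "\<And>i. emeasure \<sigma> (E i) \<noteq> \<infinity>"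
    using sigma_finite by metis
  have "\<exists>L. compact L \<and> L \<subseteq> E i \<and> emeasure \<sigma> (E i - L) \<le> ennreal (inverse (real (Suc j)))" for i j
    by (rule radon_inner_finite[OF R, of "E i" "ennreal (inverse (real (Suc j)))"])
       (use E R in \<open>auto simp: less_top\<close>)
  then obtain L where L: "\<And>i j. compact (L i j)" "\<And>i j. L i j \<subseteq> E i"
    "\<And>i j. emeasure \<sigma> (E i - L i j) \<le> ennreal (inverse (real (Suc j)))" by metis
  have Lb [measurable]: "L i j \<in> sets \<sigma>" for i j using L(1) R by (simp add: borel_compact)
  have [measurable]: "E i \<in> sets \<sigma>" for i using E by auto
  have "emeasure \<sigma> (E i - (\<Union>j. L i j)) = 0" for i
  proof -
    have "emeasure \<sigma> (E i - (\<Union>j. L i j)) \<le> 0 + ennreal e" if "0 < e" for e :: real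
    proof -
      obtain j where j: "inverse (real (Suc j)) < e" using reals_Archimedean[OF \<open>0 < e\<close>] by auto
      have "emeasure \<sigma> (E i - (\<Union>j. L i j)) \<le> emeasure \<sigma> (E i - L i j)"
        by (intro emeasure_mono) auto
      also have "\<dots> \<le> ennreal e" using j by (intro order_trans[OF L(3)] ennreal_leI) simp
      finally show ?thesis by simp
    qed
    then have "emeasure \<sigma> (E i - (\<Union>j. L i j)) \<le> 0" by (rule ennreal_le_epsilon)
    then show ?thesis by simp
  qed
  then have "AE x in \<sigma>. x \<notin> E i - (\<Union>j. L i j)" for i by (intro AE_not_in null_setsI) auto
  then have ae: "AE x in \<sigma>. \<forall>i. x \<notin> E i - (\<Union>j. L i j)" by (simp add: AE_all_countable)
  let ?K = "\<lambda>n. \<Union>i\<in>{..n}. \<Union>j\<in>{..n}. L i j"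
  show ?thesis
  proof (rule that[of ?K])
    show "\<forall>n. compact (?K n)" using L(1) by (auto intro!: compact_UN)
    show "incseq ?K" by (rule incseq_SucI) (auto intro: le_SucI)
    show "AE x in \<sigma>. \<exists>n. x \<in> ?K n"
      using ae
    proof (rule AE_mp, intro AE_I2 impI)
      fix x assume x: "x \<in> space \<sigma>" "\<forall>i. x \<notin> E i - (\<Union>j. L i j)"
      then obtain i where "x \<in> E i" using E(2) by auto
      then obtain j where "x \<in> L i j" using x by auto
      then show "\<exists>n. x \<in> ?K n" by (intro exI[of _ "max i j"] UN_I[of i] UN_I[of j]) auto
    qed
  qed
qed

lemma SUP_min_of_nat: "(SUP n. min y (of_nat n)) = (y :: ennreal)"
  using inf_SUP[of y "of_nat :: nat \<Rightarrow> ennreal" UNIV]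
  by (simp add: inf_min ennreal_SUP_of_nat_eq_top min_absorb1)

definition trunc :: "(nat \<Rightarrow> 'a set) \<Rightarrow> nat \<Rightarrow> ('a \<Rightarrow> ennreal) \<Rightarrow> 'a \<Rightarrow> ennreal" where
  "trunc F n f x = indicator (F n) x * min (f x) (of_nat n)"

lemma trunc_measurable [measurable]:
  assumes [measurable]: "f \<in> borel_measurable M" "F n \<in> sets M"
  shows "trunc F n f \<in> borel_measurable M"
  unfolding trunc_def by measurable

lemma trunc_le: "trunc F n f x \<le> f x"
  by (auto simp: trunc_def indicator_def)

lemma incseq_indicator_mult:
  assumes "incseq F" "incseq (h :: nat \<Rightarrow> ennreal)"
  shows "incseq (\<lambda>n. indicator (F n) x * h n)"
proof (rule incseq_SucI)
  fix n
  have "indicator (F n) x \<le> (indicator (F (Suc n)) x :: ennreal)"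
    using assms(1) by (auto simp: indicator_def dest: incseq_SucD)
  then show "indicator (F n) x * h n \<le> indicator (F (Suc n)) x * h (Suc n)"
    using assms(2) by (intro mult_mono) (auto dest: incseq_SucD)
qed

lemma SUP_indicator_mult:
  assumes "incseq F" "incseq (h :: nat \<Rightarrow> ennreal)" "x \<in> F m"
  shows "(SUP n. indicator (F n) x * h n) = (SUP n. h n)"
proof (rule antisym)
  show "(SUP n. indicator (F n) x * h n) \<le> (SUP n. h n)"
    by (rule SUP_mono) (auto simp: indicator_def)
  show "(SUP n. h n) \<le> (SUP n. indicator (F n) x * h n)"
  proof (rule SUP_mono)
    fix n
    have "x \<in> F (max n m)" using assms by (meson incseqD max.cobounded2 subsetD)
    then have "h n \<le> indicator (F (max n m)) x * h (max n m)"
      using assms(2) by (simp add: incseqD)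
    then show "\<exists>k\<in>UNIV. h n \<le> indicator (F k) x * h k" by blast
  qed
qed

lemma incseq_min_of_nat: "incseq (\<lambda>n. min (y :: ennreal) (of_nat n))"
  by (intro incseq_SucI min.mono of_nat_mono) auto

lemma trunc_incseq: "incseq F \<Longrightarrow> incseq (\<lambda>n. trunc F n f x)"
  unfolding trunc_def by (intro incseq_indicator_mult incseq_min_of_nat)

lemma trunc_SUP:
  assumes "incseq F" "AE x in M. \<exists>n. x \<in> F n"
  shows "AE x in M. f x = (SUP n. trunc F n f x)"
  using assms(2)
proof (rule AE_mp, intro AE_I2 impI)
  fix x assume "\<exists>n. x \<in> F n"
  then obtain m where "x \<in> F m" by auto
  then show "f x = (SUP n. trunc F n f x)"
    unfolding trunc_def using SUP_indicator_mult[OF assms(1) incseq_min_of_nat] by (simp add: SUP_min_of_nat)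
qed

lemma wpotential_pos:
  fixes \<sigma> :: "'a::t2_space measure"
  assumes R: "radon_measure \<sigma>" and lsc: "lower_semicontinuous_kernel G" and pos: "\<And>x y. 0 < G x y"
    and f: "f \<in> borel_measurable \<sigma>" and nz: "\<not> (AE y in \<sigma>. f y = 0)"
  shows "0 < wpotential G \<sigma> f x"
proof (rule ccontr)
  note borel_measurable_kernel[OF lsc, of x, measurable] radon_sets[OF R, measurable_cong] f [measurable]
  assume "\<not> 0 < wpotential G \<sigma> f x"
  then have "(\<integral>\<^sup>+ y. G x y * f y \<partial>\<sigma>) = 0" by (simp add: wpotential_def)
  then have "AE y in \<sigma>. G x y * f y = 0"
    by (subst (asm) nn_integral_0_iff_AE) auto
  then have "AE y in \<sigma>. f y = 0"
    by (rule eventually_mono) (metis mult_eq_0_iff order_less_irrefl pos)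
  then show False using nz by blast
qed

text \<open>
  The hypotheses with the constants \<open>a\<close> of quasi-symmetry and \<open>h\<close> of the maximum principle chosen.
  The \<open>\<sigma>\<close>-finiteness of \<open>\<sigma>\<close> will follow from any one of the conditions to be compared.
\<close>

locale wmp_kernel =
  fixes G :: "'a::t2_space \<Rightarrow> 'a \<Rightarrow> ennreal" and \<sigma> :: "'a measure" and a h :: real
  assumes radon: "radon_measure \<sigma>" and sigma_finite: "sigma_finite_measure \<sigma>"
    and lsc: "lower_semicontinuous_kernel G" and pos: "0 < G x y"
    and a_pos: "0 < a" and quasi_sym: "G x y \<le> ennreal a * G y x"
    and h_ge_1: "1 \<le> h"
    and wmp: "radon_measure \<nu> \<Longrightarrow> 0 < M \<Longrightarrow> (\<forall>y\<in>msupp \<nu>. potential G \<nu> y \<le> ennreal M) \<Longrightarrow>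
               potential G \<nu> x \<le> ennreal (h * M)"
begin

abbreviation T :: "('a \<Rightarrow> ennreal) \<Rightarrow> 'a \<Rightarrow> ennreal" where
  "T \<equiv> wpotential G \<sigma>"

declare radon_sets [OF radon, measurable_cong]

lemma borel_measurable_\<sigma>: "borel_measurable \<sigma> = borel_measurable borel"
  by (rule radon_measurable[OF radon])

lemma space_\<sigma> [simp]: "space \<sigma> = UNIV" by (rule radon_space[OF radon])

lemma measurable_G [measurable (raw)]:
  "f \<in> measurable M borel \<Longrightarrow> (\<lambda>y. G x (f y)) \<in> borel_measurable M"
  by (rule measurable_compose[OF _ borel_measurable_kernel[OF lsc]])

lemma T_mono_AE: "AE y in \<sigma>. f y \<le> g y \<Longrightarrow> T f x \<le> T g x"
  unfolding wpotential_def by (intro nn_integral_mono_AE) (auto elim!: eventually_mono intro: mult_left_mono)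

lemma T_mono: "(\<And>y. f y \<le> g y) \<Longrightarrow> T f x \<le> T g x"
  by (rule T_mono_AE) simp

lemma T_cong_AE: "AE y in \<sigma>. f y = g y \<Longrightarrow> T f x = T g x"
  by (intro antisym T_mono_AE) (auto elim: eventually_mono)

lemma T_cmult: "f \<in> borel_measurable \<sigma> \<Longrightarrow> T (\<lambda>y. c * f y) x = c * T f x"
  unfolding wpotential_def by (subst nn_integral_cmult[symmetric]) (auto simp: ac_simps)

lemma T_add: "f \<in> borel_measurable \<sigma> \<Longrightarrow> g \<in> borel_measurable \<sigma> \<Longrightarrow>
    T (\<lambda>y. f y + g y) x = T f x + T g x"
  unfolding wpotential_def by (subst nn_integral_add[symmetric]) (auto simp: distrib_left)

lemma T_SUP:
  assumes [measurable]: "\<And>n. f n \<in> borel_measurable \<sigma>"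
    and inc: "\<And>y. incseq (\<lambda>n. f n y)"
    and lim: "AE y in \<sigma>. g y = (SUP n. f n y)"
  shows "T g x = (SUP n. T (f n) x)"
proof -
  have "T g x = T (\<lambda>y. SUP n. f n y) x" by (rule T_cong_AE[OF lim])
  also have "\<dots> = (\<integral>\<^sup>+ y. (SUP n. G x y * f n y) \<partial>\<sigma>)"
    unfolding wpotential_def by (simp add: SUP_mult_left_ennreal)
  also have "\<dots> = (SUP n. T (f n) x)"
    unfolding wpotential_def using inc
    by (intro nn_integral_monotone_convergence_SUP) (auto simp: incseq_def le_fun_def intro: mult_left_mono)
  finally show ?thesis .
qed

lemma T_eq_potential:
  assumes "f \<in> borel_measurable \<sigma>"
  shows "T f x = potential G (density \<sigma> f) x"
  unfolding wpotential_def potential_def using assms by (subst nn_integral_density) (auto simp: ac_simps)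

definition K :: "nat \<Rightarrow> 'a set" where
  "K = (SOME K. (\<forall>n. compact (K n)) \<and> incseq K \<and> (AE x in \<sigma>. \<exists>n. x \<in> K n))"

lemma K: "compact (K n)" "incseq K" "AE x in \<sigma>. \<exists>n. x \<in> K n"
proof -
  have "\<exists>K. (\<forall>n. compact (K n)) \<and> incseq K \<and> (AE x in \<sigma>. \<exists>n. x \<in> K n)"
    by (rule radon_sigma_finite_exhaustion[OF radon sigma_finite]) blast
  then have "(\<forall>n. compact (K n)) \<and> incseq K \<and> (AE x in \<sigma>. \<exists>n. x \<in> K n)"
    unfolding K_def by (rule someI_ex)
  then show "compact (K n)" "incseq K" "AE x in \<sigma>. \<exists>n. x \<in> K n" by auto
qed

lemma K_sets [measurable]: "K n \<in> sets borel"
  using K(1) by (simp add: borel_compact)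

lemma trunc_density_radon:
  assumes "f \<in> borel_measurable \<sigma>"
  shows "radon_measure (density \<sigma> (trunc K n f))" "emeasure (density \<sigma> (trunc K n f)) UNIV < \<infinity>"
proof -
  have m: "trunc K n f \<in> borel_measurable borel"
    using trunc_measurable[OF assms, of K n] K_sets by (simp add: borel_measurable_\<sigma>)
  have b: "trunc K n f x \<le> ennreal (real n)" for x
    by (auto simp: trunc_def indicator_def ennreal_of_nat_eq_real_of_nat)
  have o: "trunc K n f x = 0" if "x \<notin> K n" for x using that by (simp add: trunc_def)
  show "radon_measure (density \<sigma> (trunc K n f))" "emeasure (density \<sigma> (trunc K n f)) UNIV < \<infinity>"
    using radon_density_bounded[OF radon K(1) m b o] by blast+
qed

lemma T_eq_SUP_trunc:
  assumes [measurable]: "f \<in> borel_measurable \<sigma>"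
  shows "T f x = (SUP n. T (trunc K n f) x)"
  by (rule T_SUP) (auto intro: trunc_incseq trunc_SUP K(2,3))

lemma T_lsc:
  assumes f: "f \<in> borel_measurable \<sigma>"
  shows "open {x. t < T f x}"
proof -
  have "{x. t < T f x} = (\<Union>n. {x. t < T (trunc K n f) x})"
    by (auto simp: T_eq_SUP_trunc[OF f] less_SUP_iff)
  also have "open \<dots>"
    using f by (intro open_UN ballI)
      (simp add: T_eq_potential potential_lsc[OF trunc_density_radon[OF f] lsc])
  finally show ?thesis .
qed

lemma T_measurable [measurable]: "f \<in> borel_measurable \<sigma> \<Longrightarrow> T f \<in> borel_measurable \<sigma>"
  using lsc_imp_borel[OF T_lsc, of f] by (simp add: borel_measurable_\<sigma>)

lemma T_pos:
  "f \<in> borel_measurable \<sigma> \<Longrightarrow> \<not> (AE y in \<sigma>. f y = 0) \<Longrightarrow> 0 < T f x"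
  using wpotential_pos[OF radon lsc pos] by blast

text \<open>
  After truncation, both \<open>f d\<sigma>\<close> and \<open>g d\<sigma>\<close> are finite Radon measures, to which Tonelli's theorem for
  lower semicontinuous kernels applies; monotone convergence removes the truncation.
\<close>

lemma T_swap:
  assumes f [measurable]: "f \<in> borel_measurable \<sigma>" and g [measurable]: "g \<in> borel_measurable \<sigma>"
  shows "(\<integral>\<^sup>+ x. g x * T f x \<partial>\<sigma>) \<le> ennreal a * (\<integral>\<^sup>+ x. f x * T g x \<partial>\<sigma>)"
proof -
  let ?R = "ennreal a * (\<integral>\<^sup>+ x. f x * T g x \<partial>\<sigma>)"
  have fin: "(\<integral>\<^sup>+ x. trunc K m g x * T (trunc K n f) x \<partial>\<sigma>) \<le> ?R" for m n
  proof -
    let ?\<nu> = "density \<sigma> (trunc K n f)" and ?\<mu> = "density \<sigma> (trunc K m g)"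
    have "(\<integral>\<^sup>+ x. trunc K m g x * T (trunc K n f) x \<partial>\<sigma>) = (\<integral>\<^sup>+ x. T (trunc K n f) x \<partial>?\<mu>)"
      by (subst nn_integral_density) auto
    also have "\<dots> = (\<integral>\<^sup>+ x. potential G ?\<nu> x \<partial>?\<mu>)" by (simp add: T_eq_potential)
    also have "\<dots> \<le> (\<integral>\<^sup>+ y. (\<integral>\<^sup>+ x. G x y \<partial>?\<mu>) \<partial>?\<nu>)"
      by (intro potential_tonelli_le trunc_density_radon lsc f g)
    also have "\<dots> \<le> (\<integral>\<^sup>+ y. (\<integral>\<^sup>+ x. ennreal a * G y x \<partial>?\<mu>) \<partial>?\<nu>)"
      by (intro nn_integral_mono quasi_sym)
    also have "\<dots> = (\<integral>\<^sup>+ y. ennreal a * T (trunc K m g) y \<partial>?\<nu>)"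
      by (subst nn_integral_cmult) (auto simp: T_eq_potential potential_def)
    also have "\<dots> = ennreal a * (\<integral>\<^sup>+ y. trunc K n f y * T (trunc K m g) y \<partial>\<sigma>)"
      by (subst nn_integral_density) (auto simp: nn_integral_cmult ac_simps)
    also have "\<dots> \<le> ?R"
      by (intro mult_left_mono nn_integral_mono mult_mono T_mono trunc_le) auto
    finally show ?thesis .
  qed
  have fin2: "(\<integral>\<^sup>+ x. trunc K m g x * T f x \<partial>\<sigma>) \<le> ?R" for m
  proof -
    have "(\<integral>\<^sup>+ x. trunc K m g x * T f x \<partial>\<sigma>) = (\<integral>\<^sup>+ x. (SUP n. trunc K m g x * T (trunc K n f) x) \<partial>\<sigma>)"
      by (simp add: T_eq_SUP_trunc[OF f] SUP_mult_left_ennreal)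
    also have "\<dots> = (SUP n. (\<integral>\<^sup>+ x. trunc K m g x * T (trunc K n f) x \<partial>\<sigma>))"
      by (intro nn_integral_monotone_convergence_SUP)
         (auto simp: incseq_def le_fun_def intro!: mult_left_mono T_mono incseqD[OF trunc_incseq[OF K(2)]])
    also have "\<dots> \<le> ?R" by (intro SUP_least fin)
    finally show ?thesis .
  qed
  have "(\<integral>\<^sup>+ x. g x * T f x \<partial>\<sigma>) = (\<integral>\<^sup>+ x. (SUP m. trunc K m g x * T f x) \<partial>\<sigma>)"
    using trunc_SUP[OF K(2,3), of g] by (intro nn_integral_cong_AE) (auto simp: SUP_mult_right_ennreal)
  also have "\<dots> = (SUP m. (\<integral>\<^sup>+ x. trunc K m g x * T f x \<partial>\<sigma>))"
    by (intro nn_integral_monotone_convergence_SUP)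
       (auto simp: incseq_def le_fun_def intro!: mult_right_mono incseqD[OF trunc_incseq[OF K(2)]])
  also have "\<dots> \<le> ?R" by (intro SUP_least fin2)
  finally show ?thesis .
qed

text \<open>
  The part of \<open>f\<close> carried by the closed set where \<open>T f \<le> t\<close> has its potential bounded by \<open>t\<close> on
  its own support, hence by \<open>h t\<close> everywhere.
\<close>

lemma T_restrict_sublevel:
  assumes f [measurable]: "f \<in> borel_measurable \<sigma>" and t: "0 < t"
  shows "T (\<lambda>y. indicator {y. T f y \<le> ennreal t} y * f y) x \<le> ennreal (h * t)"
proof -
  let ?S = "{y. T f y \<le> ennreal t}"
  have S: "open (- ?S)" using T_lsc[OF f, of "ennreal t"] by (simp add: Collect_neg_eq[symmetric] not_le)
  then have [measurable]: "?S \<in> sets borel" by (metis borel_closed closed_def)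
  define g where "g = (\<lambda>y. indicator ?S y * f y)"
  have g [measurable]: "g \<in> borel_measurable \<sigma>" unfolding g_def by measurable
  have "T (trunc K n g) x \<le> ennreal (h * t)" for n
  proof -
    let ?\<nu> = "density \<sigma> (trunc K n g)"
    have "emeasure ?\<nu> (- ?S) = (\<integral>\<^sup>+ y. trunc K n g y * indicator (- ?S) y \<partial>\<sigma>)"
      using S by (intro emeasure_density) (auto simp: radon)
    also have "\<dots> = (\<integral>\<^sup>+ y. 0 \<partial>\<sigma>)"
      by (intro nn_integral_cong) (auto simp: trunc_def g_def indicator_def)
    finally have "emeasure ?\<nu> (- ?S) = 0" by simp
    then have sub: "msupp ?\<nu> \<subseteq> ?S" using S unfolding msupp_def by blast
    have "potential G ?\<nu> y \<le> ennreal t" if "y \<in> msupp ?\<nu>" for y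
    proof -
      have "potential G ?\<nu> y = T (trunc K n g) y" by (simp add: T_eq_potential)
      also have "\<dots> \<le> T f y"
        by (intro T_mono order_trans[OF trunc_le]) (auto simp: g_def indicator_def)
      also have "\<dots> \<le> ennreal t" using sub that by auto
      finally show ?thesis .
    qed
    then show ?thesis
      using wmp[OF trunc_density_radon(1)[OF g] t] by (simp add: T_eq_potential)
  qed
  then show ?thesis
    unfolding g_def[symmetric] T_eq_SUP_trunc[OF g] by (intro SUP_least)
qed

text \<open>
  The constant of the power estimate below: the factor \<open>2\<close> accounts for keeping only half of the
  potential, and \<open>2 h\<close> for the height \<open>T f x / (2 h)\<close> at which the function is cut.
\<close>

definition \<kappa> :: "real \<Rightarrow> real" where
  "\<kappa> s = 2 * (2 * h) powr (s - 1)"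

lemma \<kappa>_pos: "0 < \<kappa> s"
  using h_ge_1 by (simp add: \<kappa>_def)

text \<open>
  With \<open>t = T f x / (2 h)\<close>, the previous lemma says that at most half of \<open>T f x\<close> comes from the set
  where \<open>T f \<le> t\<close>; on the rest the weight \<open>(T f)\<^sup>s\<^sup>-\<^sup>1\<close> exceeds \<open>t\<^sup>s\<^sup>-\<^sup>1\<close>.
\<close>

lemma T_power_le:
  assumes f [measurable]: "f \<in> borel_measurable \<sigma>" and s: "1 < s"
  shows "T f x epowr s \<le> ennreal (\<kappa> s) * T (\<lambda>y. f y * T f y epowr (s - 1)) x"
proof -
  let ?S = "\<lambda>t. {y. T f y \<le> ennreal t}"
  let ?W = "T (\<lambda>y. f y * T f y epowr (s - 1)) x"
  have split: "T f x \<le> ennreal (h * t) + T (\<lambda>y. indicator (- ?S t) y * f y) x" if "0 < t" for t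
  proof -
    have [measurable]: "?S t \<in> sets borel"
      using T_measurable[OF f] by (simp add: borel_measurable_\<sigma>)
    have "T f x = T (\<lambda>y. indicator (?S t) y * f y + indicator (- ?S t) y * f y) x"
      by (intro arg_cong2[where f = T] ext) (auto simp: indicator_def)
    also have "\<dots> = T (\<lambda>y. indicator (?S t) y * f y) x + T (\<lambda>y. indicator (- ?S t) y * f y) x"
      by (intro T_add) auto
    finally show ?thesis using T_restrict_sublevel[OF f that, of x] by (simp add: add_right_mono)
  qed
  have weight: "ennreal (t powr (s - 1)) * T (\<lambda>y. indicator (- ?S t) y * f y) x \<le> ?W" if "0 < t" for t
  proof -
    have [measurable]: "?S t \<in> sets borel"
      using T_measurable[OF f] by (simp add: borel_measurable_\<sigma>)
    have "ennreal (t powr (s - 1)) * T (\<lambda>y. indicator (- ?S t) y * f y) x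
        = T (\<lambda>y. ennreal (t powr (s - 1)) * (indicator (- ?S t) y * f y)) x"
      by (rule T_cmult[symmetric]) measurable
    also have "\<dots> \<le> ?W"
    proof (rule T_mono)
      fix y
      show "ennreal (t powr (s - 1)) * (indicator (- ?S t) y * f y) \<le> f y * T f y epowr (s - 1)"
      proof (cases "T f y \<le> ennreal t")
        case False
        then have "ennreal t epowr (s - 1) \<le> T f y epowr (s - 1)" using s by (intro epowr_mono) auto
        then show ?thesis using False that by (simp add: ennreal_epowr mult.commute mult_left_mono)
      qed simp
    qed
    finally show ?thesis .
  qed
  show ?thesis
  proof (cases "T f x")
    case top
    then have "T (\<lambda>y. indicator (- ?S 1) y * f y) x = top" using split[of 1] by (simp add: top_unique)
    then have "?W = top" using weight[of 1] by (simp add: top_unique)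
    then show ?thesis using \<kappa>_pos[of s] by (simp add: ennreal_mult_top)
  next
    case (real \<alpha>)
    show ?thesis
    proof (cases "\<alpha> = 0")
      case False
      define t where "t = \<alpha> / (2 * h)"
      have t: "0 < t" "h * t = \<alpha> / 2" using real False h_ge_1 by (auto simp: t_def)
      let ?Y = "T (\<lambda>y. indicator (- ?S t) y * f y) x"
      have "ennreal \<alpha> \<le> ennreal (\<alpha> / 2) + ?Y" using split[OF t(1)] real t(2) by simp
      moreover have "ennreal \<alpha> = ennreal (\<alpha> / 2) + ennreal (\<alpha> / 2)"
        using real by (simp flip: ennreal_plus)
      ultimately have Y: "ennreal (\<alpha> / 2) \<le> ?Y" by (simp add: ennreal_add_left_cancel_le)
      have "\<alpha> powr s = \<kappa> s * (t powr (s - 1) * (\<alpha> / 2))"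
      proof -
        have "2 * h * t = \<alpha>" using t(2) by simp
        then have "\<alpha> powr (s - 1) = (2 * h) powr (s - 1) * t powr (s - 1)"
          using h_ge_1 t(1) powr_mult[of "2 * h" t "s - 1"] by simp
        moreover have "\<alpha> powr s = \<alpha> * \<alpha> powr (s - 1)"
          using False real by (simp add: powr_diff)
        ultimately show ?thesis by (simp add: \<kappa>_def)
      qed
      then have "T f x epowr s = ennreal (\<kappa> s) * (ennreal (t powr (s - 1)) * ennreal (\<alpha> / 2))"
        using real \<kappa>_pos[of s] by (simp add: ennreal_epowr flip: ennreal_mult)
      also have "\<dots> \<le> ennreal (\<kappa> s) * (ennreal (t powr (s - 1)) * ?Y)"
        using Y by (intro mult_left_mono) auto
      also have "\<dots> \<le> ennreal (\<kappa> s) * ?W"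
        using weight[OF t(1)] by (intro mult_left_mono) auto
      finally show ?thesis .
    qed (use real in simp)
  qed
qed

end

section \<open>Boundedness on Lebesgue spaces\<close>

context wmp_kernel
begin

text \<open>
  The sets are \<open>K n\<close> cut down to \<open>w \<ge> 1 / n\<close> and \<open>T w \<le> n\<close>, where \<open>T (indicator F) \<le> n T w \<le> n\<^sup>2\<close>.
  All absorption arguments below take place on such sets, because there the quantities to be
  absorbed are finite.
\<close>

lemma good_exhaustion:
  assumes w [measurable]: "w \<in> borel_measurable \<sigma>" and w_pos: "AE x in \<sigma>. 0 < w x"
    and Tw: "AE x in \<sigma>. T w x < top"
  obtains F :: "nat \<Rightarrow> 'a set" where "\<forall>n. F n \<in> sets borel" "incseq F"
    "AE x in \<sigma>. \<exists>n. x \<in> F n" "\<forall>n. emeasure \<sigma> (F n) < top"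
    "\<forall>n. \<forall>x\<in>F n. 1 \<le> of_nat n * w x"
    "\<forall>n. \<forall>x\<in>F n. T (indicator (F n)) x \<le> of_nat (n * n)"
proof
  let ?F = "\<lambda>n. K n \<inter> {x. 1 \<le> of_nat n * w x} \<inter> {x. T w x \<le> of_nat n}"
  have F [measurable]: "?F n \<in> sets borel" for n
  proof -
    have "{x. 1 \<le> of_nat n * w x} \<in> sets borel" "{x. T w x \<le> of_nat n} \<in> sets borel"
      using w T_measurable[OF w] unfolding borel_measurable_\<sigma> by measurable
    then show ?thesis by (intro sets.Int K_sets)
  qed
  show "\<forall>n. ?F n \<in> sets borel" using F by blast
  show "incseq ?F"
  proof (rule incseq_SucI)
    fix n
    have le: "(of_nat n :: ennreal) \<le> of_nat (Suc n)" by (rule of_nat_mono) simp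
    then have "of_nat n * w x \<le> of_nat (Suc n) * w x" for x by (intro mult_right_mono) auto
    then show "?F n \<subseteq> ?F (Suc n)"
      using incseq_SucD[OF K(2), of n] le by (blast intro: order_trans)
  qed
  show "AE x in \<sigma>. \<exists>n. x \<in> ?F n"
    using K(3) w_pos Tw
  proof eventually_elim
    fix x assume "\<exists>n. x \<in> K n" "0 < w x" "T w x < top"
    then obtain m k l where m: "x \<in> K m" and k: "1 \<le> of_nat k * w x" and l: "T w x \<le> of_nat l"
      by (meson ex_of_nat_ge ex_of_nat_mult_ge_one)
    let ?n = "max m (max k l)"
    have "K m \<subseteq> K ?n" using K(2) by (rule incseqD) simp
    moreover have "of_nat k * w x \<le> of_nat ?n * w x" by (intro mult_right_mono of_nat_mono) auto
    moreover have "(of_nat l :: ennreal) \<le> of_nat ?n" by (intro of_nat_mono) auto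
    ultimately show "\<exists>n. x \<in> ?F n" using m k l by (intro exI[of _ ?n]) (auto intro: order_trans)
  qed
  show "\<forall>n. emeasure \<sigma> (?F n) < top"
  proof
    fix n
    have "emeasure \<sigma> (?F n) \<le> emeasure \<sigma> (K n)" by (intro emeasure_mono) auto
    also have "\<dots> < top" using radon_compact_finite[OF radon K(1)] by simp
    finally show "emeasure \<sigma> (?F n) < top" .
  qed
  show "\<forall>n. \<forall>x\<in>?F n. 1 \<le> of_nat n * w x" by blast
  show "\<forall>n. \<forall>x\<in>?F n. T (indicator (?F n)) x \<le> of_nat (n * n)"
  proof (intro allI ballI)
    fix n x assume x: "x \<in> ?F n"
    have "T (indicator (?F n)) x \<le> T (\<lambda>y. of_nat n * w y) x"
      by (rule T_mono) (auto simp: indicator_def)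
    also have "\<dots> = of_nat n * T w x" by (rule T_cmult[OF w])
    also have "\<dots> \<le> of_nat n * of_nat n" using x by (intro mult_left_mono) auto
    finally show "T (indicator (?F n)) x \<le> of_nat (n * n)" by simp
  qed
qed

abbreviation A :: "'a \<Rightarrow> ennreal" where
  "A \<equiv> T (\<lambda>_. 1)"

lemma T_indicator_le_A: "T (indicator F) x \<le> A x"
  by (rule T_mono) (auto simp: indicator_def)

text \<open>
  The adjoint form of the boundedness of \<open>f \<mapsto> T f / A\<close>. With \<open>\<psi> = T (g / A)\<close>, integrate
  \<open>\<psi>\<^sup>s \<le> \<kappa> T (\<psi>\<^sup>s\<^sup>-\<^sup>1 g / A)\<close>, move \<open>T\<close> to the other side, where it produces at most \<open>A\<close> and cancels
  the denominator, and absorb the resulting integral of \<open>\<psi>\<^sup>s\<^sup>-\<^sup>1 g\<close>.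
\<close>

lemma T_dual_bound:
  assumes s: "1 < s"
  obtains C :: real where "0 < C"
    "\<forall>F g. F \<in> sets borel \<longrightarrow> g \<in> borel_measurable \<sigma> \<longrightarrow> (\<forall>x. x \<notin> F \<longrightarrow> g x = 0) \<longrightarrow>
       (\<integral>\<^sup>+ x. indicator F x * T (\<lambda>y. g y / A y) x epowr s \<partial>\<sigma>) < top \<longrightarrow>
       (\<integral>\<^sup>+ x. indicator F x * T (\<lambda>y. g y / A y) x epowr s \<partial>\<sigma>) \<le> ennreal C * (\<integral>\<^sup>+ x. g x epowr s \<partial>\<sigma>)"
proof -
  define P where "P = s / (s - 1)"
  have P: "1 < P" "P / (P - 1) = s" "(s - 1) * P = s" using s by (auto simp: P_def field_simps)
  define \<epsilon> where "\<epsilon> = 1 / (2 * (\<kappa> s * a))"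
  have \<epsilon>: "0 < \<epsilon>" using \<kappa>_pos a_pos by (simp add: \<epsilon>_def)
  obtain D where D: "0 < D"
    "\<And>x y :: ennreal. x * y \<le> ennreal \<epsilon> * x epowr P + ennreal D * y epowr (P / (P - 1))"
    using young_epsilon[OF P(1) \<epsilon>] by blast
  show ?thesis
  proof (rule that[of "2 * (\<kappa> s * a * D)"])
    show "0 < 2 * (\<kappa> s * a * D)" using \<kappa>_pos a_pos D by simp
    show "\<forall>F g. F \<in> sets borel \<longrightarrow> g \<in> borel_measurable \<sigma> \<longrightarrow> (\<forall>x. x \<notin> F \<longrightarrow> g x = 0) \<longrightarrow>
       (\<integral>\<^sup>+ x. indicator F x * T (\<lambda>y. g y / A y) x epowr s \<partial>\<sigma>) < top \<longrightarrow>
       (\<integral>\<^sup>+ x. indicator F x * T (\<lambda>y. g y / A y) x epowr s \<partial>\<sigma>)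
         \<le> ennreal (2 * (\<kappa> s * a * D)) * (\<integral>\<^sup>+ x. g x epowr s \<partial>\<sigma>)"
    proof (intro allI impI)
      fix F and g :: "'a \<Rightarrow> ennreal"
      assume F [measurable]: "F \<in> sets borel" and g [measurable]: "g \<in> borel_measurable \<sigma>"
        and off: "\<forall>x. x \<notin> F \<longrightarrow> g x = 0"
      define \<psi> where "\<psi> = T (\<lambda>y. g y / A y)"
      have \<psi> [measurable]: "\<psi> \<in> borel_measurable \<sigma>" unfolding \<psi>_def by measurable
      let ?I = "\<integral>\<^sup>+ x. indicator F x * \<psi> x epowr s \<partial>\<sigma>"
      assume fin: "(\<integral>\<^sup>+ x. indicator F x * T (\<lambda>y. g y / A y) x epowr s \<partial>\<sigma>) < top"
      let ?k = "\<lambda>y. g y / A y * \<psi> y epowr (s - 1)"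
      have k: "?k y * T (indicator F) y
          \<le> ennreal \<epsilon> * (indicator F y * \<psi> y epowr s) + ennreal D * g y epowr s" for y
      proof -
        have "?k y * T (indicator F) y \<le> ?k y * A y"
          by (intro mult_left_mono T_indicator_le_A) auto
        also have "\<dots> = (g y / A y * A y) * \<psi> y epowr (s - 1)" by (simp add: ac_simps)
        also have "\<dots> \<le> g y * \<psi> y epowr (s - 1)"
          by (intro mult_right_mono ennreal_divide_mult_le) auto
        also have "\<dots> = (indicator F y * \<psi> y epowr (s - 1)) * g y"
          using off by (auto simp: indicator_def ac_simps)
        also have "\<dots> \<le> ennreal \<epsilon> * (indicator F y * \<psi> y epowr (s - 1)) epowr P
            + ennreal D * g y epowr (P / (P - 1))" by (rule D(2))
        also have "(indicator F y * \<psi> y epowr (s - 1)) epowr P = indicator F y * \<psi> y epowr s"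
          using P s by (simp add: epowr_indicator epowr_epowr)
        finally show ?thesis using P(2) by simp
      qed
      have "?I \<le> (\<integral>\<^sup>+ x. ennreal (\<kappa> s) * (indicator F x * T ?k x) \<partial>\<sigma>)"
        unfolding \<psi>_def using T_power_le[OF _ s, of "\<lambda>y. g y / A y"]
        by (intro nn_integral_mono) (auto simp: indicator_def)
      also have "\<dots> = ennreal (\<kappa> s) * (\<integral>\<^sup>+ x. indicator F x * T ?k x \<partial>\<sigma>)"
        by (rule nn_integral_cmult) measurable
      also have "\<dots> \<le> ennreal (\<kappa> s) * (ennreal a * (\<integral>\<^sup>+ y. ?k y * T (indicator F) y \<partial>\<sigma>))"
        by (intro mult_left_mono T_swap) auto
      also have "\<dots> \<le> ennreal (\<kappa> s) * (ennreal a *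
          (\<integral>\<^sup>+ y. ennreal \<epsilon> * (indicator F y * \<psi> y epowr s) + ennreal D * g y epowr s \<partial>\<sigma>))"
        by (intro mult_left_mono nn_integral_mono k) auto
      also have "\<dots> = ennreal (\<kappa> s * a) * (ennreal \<epsilon> * ?I + ennreal D * (\<integral>\<^sup>+ y. g y epowr s \<partial>\<sigma>))"
        using \<kappa>_pos[of s] a_pos by (simp add: nn_integral_add nn_integral_cmult ennreal_mult mult.assoc)
      also have "\<dots> = ennreal (\<kappa> s * a * \<epsilon>) * ?I + ennreal (\<kappa> s * a * D) * (\<integral>\<^sup>+ y. g y epowr s \<partial>\<sigma>)"
        using \<kappa>_pos[of s] a_pos D(1) \<epsilon> by (simp add: ennreal_mult distrib_left mult.assoc)
      also have "\<kappa> s * a * \<epsilon> = 1 / 2" using \<kappa>_pos[of s] a_pos by (simp add: \<epsilon>_def)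
      finally have "?I \<le> ennreal (\<kappa> s * a * D) * (\<integral>\<^sup>+ y. g y epowr s \<partial>\<sigma>) + ennreal (1 / 2) * ?I"
        by (simp add: add.commute)
      then have "?I \<le> 2 * (ennreal (\<kappa> s * a * D) * (\<integral>\<^sup>+ y. g y epowr s \<partial>\<sigma>))"
        by (rule absorb_half) (use fin in \<open>simp add: \<psi>_def\<close>)
      also have "\<dots> = ennreal (2 * (\<kappa> s * a * D)) * (\<integral>\<^sup>+ y. g y epowr s \<partial>\<sigma>)"
        using \<kappa>_pos[of s] a_pos D(1) by (subst ennreal_mult) (auto simp: mult.assoc)
      finally show "(\<integral>\<^sup>+ x. indicator F x * T (\<lambda>y. g y / A y) x epowr s \<partial>\<sigma>)
         \<le> ennreal (2 * (\<kappa> s * a * D)) * (\<integral>\<^sup>+ x. g x epowr s \<partial>\<sigma>)" by (simp only: \<psi>_def)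
    qed
  qed
qed

text \<open>
  By duality: test \<open>\<phi> = T f / A\<close> against \<open>g = \<phi>\<^sup>p\<^sup>-\<^sup>1\<close> and use the adjoint bound with the conjugate exponent.
  The truncation of \<open>f\<close> to \<open>F n\<close> and to height \<open>n\<close> makes \<open>\<phi> \<le> n\<close>, so that everything absorbed is finite.
\<close>

lemma T_quotient_bound:
  assumes p: "1 < p" and A_pos: "\<And>x. 0 < A x" and A_fin: "AE x in \<sigma>. A x < top"
  obtains C :: real where "0 < C"
    "\<forall>f. f \<in> borel_measurable \<sigma> \<longrightarrow>
       (\<integral>\<^sup>+ x. (T f x / A x) epowr p \<partial>\<sigma>) \<le> ennreal C * (\<integral>\<^sup>+ x. f x epowr p \<partial>\<sigma>)"
proof -
  define s where "s = p / (p - 1)"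
  have s: "1 < s" "s / (s - 1) = p" "(p - 1) * s = p" using p by (auto simp: s_def field_simps)
  obtain C :: real where C: "0 < C"
    "\<forall>F g. F \<in> sets borel \<longrightarrow> g \<in> borel_measurable \<sigma> \<longrightarrow> (\<forall>x. x \<notin> F \<longrightarrow> g x = 0) \<longrightarrow>
       (\<integral>\<^sup>+ x. indicator F x * T (\<lambda>y. g y / A y) x epowr s \<partial>\<sigma>) < top \<longrightarrow>
       (\<integral>\<^sup>+ x. indicator F x * T (\<lambda>y. g y / A y) x epowr s \<partial>\<sigma>) \<le> ennreal C * (\<integral>\<^sup>+ x. g x epowr s \<partial>\<sigma>)"
    by (rule T_dual_bound[OF s(1)]) (rule that)
  define \<epsilon> where "\<epsilon> = 1 / (2 * (a * C))"
  have \<epsilon>: "0 < \<epsilon>" using C(1) a_pos by (simp add: \<epsilon>_def)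
  obtain D where D: "0 < D"
    "\<And>x y :: ennreal. x * y \<le> ennreal \<epsilon> * x epowr s + ennreal D * y epowr (s / (s - 1))"
    using young_epsilon[OF s(1) \<epsilon>] by blast
  let ?w = "\<lambda>x. min 1 (A x)"
  have Tw: "AE x in \<sigma>. T ?w x < top"
    using A_fin by (rule eventually_mono) (rule order_le_less_trans[OF T_mono], simp_all)
  obtain F where F: "\<forall>n. F n \<in> sets borel" "incseq F"
    "AE x in \<sigma>. \<exists>n. x \<in> F n" "\<forall>n. emeasure \<sigma> (F n) < top"
    "\<forall>n. \<forall>x\<in>F n. 1 \<le> of_nat n * ?w x"
    "\<forall>n. \<forall>x\<in>F n. T (indicator (F n)) x \<le> of_nat (n * n)"
    by (rule good_exhaustion[of ?w]) (use A_pos Tw in auto)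
  note F(1)[rule_format, measurable]
  have bound: "(\<integral>\<^sup>+ x. indicator (F n) x * (T (trunc F n f) x / A x) epowr p \<partial>\<sigma>)
      \<le> ennreal (2 * (a * D)) * (\<integral>\<^sup>+ x. f x epowr p \<partial>\<sigma>)"
    if f [measurable]: "f \<in> borel_measurable \<sigma>" for f n
  proof -
    define f' where "f' = trunc F n f"
    have f' [measurable]: "f' \<in> borel_measurable \<sigma>" unfolding f'_def by measurable
    define \<phi> where "\<phi> x = T f' x / A x" for x
    have \<phi> [measurable]: "\<phi> \<in> borel_measurable \<sigma>" unfolding \<phi>_def by measurable
    define g where "g x = indicator (F n) x * \<phi> x epowr (p - 1)" for x
    have g [measurable]: "g \<in> borel_measurable \<sigma>" unfolding g_def by measurable
    have off: "\<forall>x. x \<notin> F n \<longrightarrow> g x = 0" by (simp add: g_def)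
    have \<phi>_le: "\<phi> x \<le> of_nat n" for x
    proof -
      have "T f' x \<le> T (\<lambda>_. of_nat n * 1) x"
        unfolding f'_def by (rule T_mono) (auto simp: trunc_def indicator_def)
      also have "\<dots> = of_nat n * A x" by (rule T_cmult) simp
      finally have "\<phi> x \<le> of_nat n * A x / A x" unfolding \<phi>_def by (rule divide_right_mono_ennreal)
      also have "\<dots> \<le> of_nat n"
        using A_pos[of x] by (cases "A x = top") (auto simp: ennreal_mult_divide_eq)
      finally show ?thesis .
    qed
    have pow_fin: "(of_nat m :: ennreal) epowr q < top" if "0 < q" for m :: nat and q :: real
      using that by (simp add: of_nat_less_top)
    have F_fin: "(\<integral>\<^sup>+ x. indicator (F n) x * c \<partial>\<sigma>) < top" if "c < top" for c
      using F(4) that by (subst nn_integral_multc) (auto simp: ennreal_mult_less_top)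
    have g_div: "g y / A y \<le> (of_nat n epowr (p - 1) * of_nat n) * indicator (F n) y" for y
    proof (cases "y \<in> F n")
      case True
      have "1 \<le> of_nat n * ?w y" using F(5) True by blast
      also have "\<dots> \<le> of_nat n * A y" by (intro mult_left_mono) auto
      finally have 1: "1 \<le> of_nat n * A y" .
      have "1 / A y \<le> of_nat n * A y / A y" using 1 by (rule divide_right_mono_ennreal)
      also have "\<dots> \<le> of_nat n"
        using A_pos[of y] by (cases "A y = top") (auto simp: ennreal_mult_divide_eq)
      finally have "inverse (A y) \<le> of_nat n" by (simp add: divide_ennreal_def)
      moreover have "g y \<le> of_nat n epowr (p - 1)"
        using True p \<phi>_le[of y] by (simp add: g_def epowr_mono)
      ultimately show ?thesis using True unfolding divide_ennreal_def by (simp add: mult_mono)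
    qed (use off in simp)
    have \<psi>_le: "T (\<lambda>y. g y / A y) x \<le> of_nat n epowr (p - 1) * of_nat n * of_nat (n * n)"
      if "x \<in> F n" for x
    proof -
      have "T (\<lambda>y. g y / A y) x
          \<le> T (\<lambda>y. (of_nat n epowr (p - 1) * of_nat n) * indicator (F n) y) x"
        by (rule T_mono[OF g_div])
      also have "\<dots> = of_nat n epowr (p - 1) * of_nat n * T (indicator (F n)) x"
        by (rule T_cmult) measurable
      also have "\<dots> \<le> of_nat n epowr (p - 1) * of_nat n * of_nat (n * n)"
        using F(6) that by (intro mult_left_mono) auto
      finally show ?thesis .
    qed
    let ?\<psi> = "T (\<lambda>y. g y / A y)"
    let ?I = "\<integral>\<^sup>+ x. indicator (F n) x * \<phi> x epowr p \<partial>\<sigma>"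
    let ?J = "\<integral>\<^sup>+ x. indicator (F n) x * ?\<psi> x epowr s \<partial>\<sigma>"
    have "?J \<le> (\<integral>\<^sup>+ x. indicator (F n) x * (of_nat n epowr (p - 1) * of_nat n * of_nat (n * n)) epowr s \<partial>\<sigma>)"
      using \<psi>_le s by (intro nn_integral_mono) (auto simp: indicator_def intro!: epowr_mono)
    also have "\<dots> < top"
      using s p pow_fin[of "p - 1" n] by (intro F_fin) (simp add: ennreal_mult_less_top of_nat_less_top)
    finally have "?J \<le> ennreal C * (\<integral>\<^sup>+ x. g x epowr s \<partial>\<sigma>)"
      by (intro C(2)[rule_format] g F(1)[rule_format]) (use off in auto)
    also have "(\<integral>\<^sup>+ x. g x epowr s \<partial>\<sigma>) = ?I"
      using s p unfolding g_def by (simp add: epowr_indicator epowr_epowr)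
    finally have J: "?J \<le> ennreal C * ?I" .
    have "?I \<le> (\<integral>\<^sup>+ x. indicator (F n) x * (of_nat n) epowr p \<partial>\<sigma>)"
      using p by (intro nn_integral_mono mult_left_mono epowr_mono \<phi>_le) auto
    also have "\<dots> < top" using p by (intro F_fin pow_fin) simp
    finally have fin: "?I < top" .
    have "?I = (\<integral>\<^sup>+ x. g x / A x * T f' x \<partial>\<sigma>)"
    proof (rule nn_integral_cong)
      fix x
      have "\<phi> x epowr p = \<phi> x epowr (p - 1) * (T f' x / A x)"
        using epowr_add[of "p - 1" 1 "\<phi> x"] p by (simp add: \<phi>_def)
      then show "indicator (F n) x * \<phi> x epowr p = g x / A x * T f' x"
        by (simp add: g_def divide_ennreal_def ac_simps)
    qed
    also have "\<dots> \<le> ennreal a * (\<integral>\<^sup>+ x. f' x * ?\<psi> x \<partial>\<sigma>)"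
      by (intro T_swap) auto
    also have "\<dots> \<le> ennreal a * (\<integral>\<^sup>+ x. ennreal \<epsilon> * (indicator (F n) x * ?\<psi> x epowr s)
        + ennreal D * f x epowr p \<partial>\<sigma>)"
    proof (intro mult_left_mono nn_integral_mono)
      fix x
      have "f' x * ?\<psi> x = (indicator (F n) x * ?\<psi> x) * f' x"
        by (auto simp: f'_def trunc_def indicator_def ac_simps)
      also have "\<dots> \<le> ennreal \<epsilon> * (indicator (F n) x * ?\<psi> x) epowr s + ennreal D * f' x epowr p"
        using D(2)[of "indicator (F n) x * ?\<psi> x" "f' x"] s by simp
      also have "\<dots> \<le> ennreal \<epsilon> * (indicator (F n) x * ?\<psi> x epowr s) + ennreal D * f x epowr p"
        using s p by (intro add_mono mult_left_mono epowr_mono)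
          (auto simp: epowr_indicator f'_def trunc_le)
      finally show "f' x * ?\<psi> x \<le> ennreal \<epsilon> * (indicator (F n) x * ?\<psi> x epowr s)
        + ennreal D * f x epowr p" .
    qed simp
    also have "\<dots> = ennreal (a * \<epsilon>) * ?J + ennreal (a * D) * (\<integral>\<^sup>+ x. f x epowr p \<partial>\<sigma>)"
      using a_pos D(1) \<epsilon>
      by (simp add: nn_integral_add nn_integral_cmult ennreal_mult distrib_left mult.assoc)
    also have "\<dots> \<le> ennreal (a * \<epsilon>) * (ennreal C * ?I) + ennreal (a * D) * (\<integral>\<^sup>+ x. f x epowr p \<partial>\<sigma>)"
      using J by (intro add_mono mult_left_mono) auto
    also have "\<dots> = ennreal (a * \<epsilon> * C) * ?I + ennreal (a * D) * (\<integral>\<^sup>+ x. f x epowr p \<partial>\<sigma>)"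
      using a_pos C(1) \<epsilon> by (simp add: ennreal_mult mult.assoc)
    also have "a * \<epsilon> * C = 1 / 2" using a_pos C(1) by (simp add: \<epsilon>_def)
    finally have "?I \<le> ennreal (a * D) * (\<integral>\<^sup>+ x. f x epowr p \<partial>\<sigma>) + ennreal (1 / 2) * ?I"
      by (simp add: add.commute)
    then have "?I \<le> 2 * (ennreal (a * D) * (\<integral>\<^sup>+ x. f x epowr p \<partial>\<sigma>))"
      using fin by (rule absorb_half)
    also have "\<dots> = ennreal (2 * (a * D)) * (\<integral>\<^sup>+ x. f x epowr p \<partial>\<sigma>)"
      using a_pos D(1) by (subst ennreal_mult) (auto simp: mult.assoc)
    finally show ?thesis unfolding \<phi>_def f'_def .
  qed
  show ?thesis
  proof (rule that[of "2 * (a * D)"])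
    show "0 < 2 * (a * D)" using a_pos D by simp
    show "\<forall>f. f \<in> borel_measurable \<sigma> \<longrightarrow>
       (\<integral>\<^sup>+ x. (T f x / A x) epowr p \<partial>\<sigma>) \<le> ennreal (2 * (a * D)) * (\<integral>\<^sup>+ x. f x epowr p \<partial>\<sigma>)"
    proof (intro allI impI)
      fix f :: "'a \<Rightarrow> ennreal"
      assume f [measurable]: "f \<in> borel_measurable \<sigma>"
      let ?q = "\<lambda>n x. (T (trunc F n f) x / A x) epowr p"
      have inc: "incseq (\<lambda>n. ?q n x)" for x
        using p trunc_incseq[OF F(2), of f]
        by (auto simp: incseq_def intro!: epowr_mono divide_right_mono_ennreal T_mono)
      have lim: "(T f x / A x) epowr p = (SUP n. ?q n x)" for x
      proof -
        have "T f x = (SUP n. T (trunc F n f) x)"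
          by (rule T_SUP) (auto intro: trunc_incseq trunc_SUP F)
        then show ?thesis
          using p by (simp add: divide_ennreal_def SUP_mult_right_ennreal epowr_SUP)
      qed
      have "(\<integral>\<^sup>+ x. (T f x / A x) epowr p \<partial>\<sigma>) = (\<integral>\<^sup>+ x. (SUP n. indicator (F n) x * ?q n x) \<partial>\<sigma>)"
        using F(3) SUP_indicator_mult[OF F(2) inc]
        by (intro nn_integral_cong_AE) (auto simp: lim elim!: eventually_mono)
      also have "\<dots> = (SUP n. (\<integral>\<^sup>+ x. indicator (F n) x * ?q n x \<partial>\<sigma>))"
        using incseq_indicator_mult[OF F(2) inc]
        by (intro nn_integral_monotone_convergence_SUP) (auto simp: incseq_def le_fun_def)
      also have "\<dots> \<le> ennreal (2 * (a * D)) * (\<integral>\<^sup>+ x. f x epowr p \<partial>\<sigma>)"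
        by (intro SUP_least bound f)
      finally show "(\<integral>\<^sup>+ x. (T f x / A x) epowr p \<partial>\<sigma>)
          \<le> ennreal (2 * (a * D)) * (\<integral>\<^sup>+ x. f x epowr p \<partial>\<sigma>)" .
    qed
  qed
qed

lemma AE_less_top_if_power_integrable:
  assumes [measurable]: "v \<in> borel_measurable \<sigma>" and "0 < \<beta>" "(\<integral>\<^sup>+ x. v x epowr \<beta> \<partial>\<sigma>) < top"
  shows "AE x in \<sigma>. v x < top"
proof -
  have "AE x in \<sigma>. v x epowr \<beta> \<noteq> \<infinity>"
    using assms by (intro nn_integral_PInf_AE) auto
  then show ?thesis using assms(2) by (auto simp: less_top elim!: eventually_mono)
qed

text \<open>
  The bound behind both the norm inequality and the existence of solutions: writing
  \<open>T f = A (T f / A)\<close>, Young's inequality separates the integrable power of \<open>A\<close>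
  from an arbitrarily small multiple of \<open>\<integral> f\<^sup>p\<close>.
\<close>

lemma T_power_integral_le:
  assumes pr: "0 < r" "r < p" "1 < p" and \<epsilon>: "0 < \<epsilon>" and A_pos: "\<And>x. 0 < A x"
    and fin: "(\<integral>\<^sup>+ x. A x epowr (p * r / (p - r)) \<partial>\<sigma>) < top"
  obtains D :: ennreal where "D < top"
    "\<forall>f. f \<in> borel_measurable \<sigma> \<longrightarrow>
       (\<integral>\<^sup>+ x. T f x epowr r \<partial>\<sigma>) \<le> D + ennreal \<epsilon> * (\<integral>\<^sup>+ x. f x epowr p \<partial>\<sigma>)"
proof -
  have A_fin: "AE x in \<sigma>. A x < top"
    using pr by (intro AE_less_top_if_power_integrable[OF _ _ fin]) auto
  obtain C :: real where C: "0 < C" "\<forall>f. f \<in> borel_measurable \<sigma> \<longrightarrow>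
       (\<integral>\<^sup>+ x. (T f x / A x) epowr p \<partial>\<sigma>) \<le> ennreal C * (\<integral>\<^sup>+ x. f x epowr p \<partial>\<sigma>)"
    by (rule T_quotient_bound[OF pr(3) A_pos A_fin]) (rule that)
  define P where "P = p / r"
  have P: "1 < P" "r * P = p" "r * (P / (P - 1)) = p * r / (p - r)" "0 < P / (P - 1)"
    using pr by (auto simp: P_def field_simps)
  have "0 < \<epsilon> / C" using C(1) \<epsilon> by simp
  then obtain D where D: "0 < D"
    "\<And>x y :: ennreal. x * y \<le> ennreal (\<epsilon> / C) * x epowr P + ennreal D * y epowr (P / (P - 1))"
    using young_epsilon[OF P(1)] by blast
  show ?thesis
  proof (rule that[of "ennreal D * (\<integral>\<^sup>+ x. A x epowr (p * r / (p - r)) \<partial>\<sigma>)"])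
    show "ennreal D * (\<integral>\<^sup>+ x. A x epowr (p * r / (p - r)) \<partial>\<sigma>) < top"
      using fin by (simp add: ennreal_mult_less_top)
    show "\<forall>f. f \<in> borel_measurable \<sigma> \<longrightarrow> (\<integral>\<^sup>+ x. T f x epowr r \<partial>\<sigma>)
       \<le> ennreal D * (\<integral>\<^sup>+ x. A x epowr (p * r / (p - r)) \<partial>\<sigma>) + ennreal \<epsilon> * (\<integral>\<^sup>+ x. f x epowr p \<partial>\<sigma>)"
    proof (intro allI impI)
      fix f :: "'a \<Rightarrow> ennreal"
      assume f [measurable]: "f \<in> borel_measurable \<sigma>"
      have "(\<integral>\<^sup>+ x. T f x epowr r \<partial>\<sigma>) \<le> (\<integral>\<^sup>+ x. ennreal (\<epsilon> / C) * (T f x / A x) epowr p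
          + ennreal D * A x epowr (p * r / (p - r)) \<partial>\<sigma>)"
        using A_fin
      proof (intro nn_integral_mono_AE, eventually_elim)
        fix x assume "A x < top"
        then have "T f x epowr r = (A x * (T f x / A x)) epowr r"
          using A_pos[of x] by (simp add: ennreal_mult_divide_cancel)
        also have "\<dots> = (T f x / A x) epowr r * A x epowr r"
          using pr by (simp add: epowr_mult mult.commute)
        also have "\<dots> \<le> ennreal (\<epsilon> / C) * ((T f x / A x) epowr r) epowr P
            + ennreal D * (A x epowr r) epowr (P / (P - 1))" by (rule D(2))
        also have "\<dots> = ennreal (\<epsilon> / C) * (T f x / A x) epowr p
          + ennreal D * A x epowr (p * r / (p - r))"
          using pr P by (simp only: epowr_epowr)
        finally show "T f x epowr r \<le> ennreal (\<epsilon> / C) * (T f x / A x) epowr p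
          + ennreal D * A x epowr (p * r / (p - r))" .
      qed
      also have "\<dots> = ennreal (\<epsilon> / C) * (\<integral>\<^sup>+ x. (T f x / A x) epowr p \<partial>\<sigma>)
          + ennreal D * (\<integral>\<^sup>+ x. A x epowr (p * r / (p - r)) \<partial>\<sigma>)"
        by (simp add: nn_integral_add nn_integral_cmult)
      also have "\<dots> \<le> ennreal (\<epsilon> / C) * (ennreal C * (\<integral>\<^sup>+ x. f x epowr p \<partial>\<sigma>))
          + ennreal D * (\<integral>\<^sup>+ x. A x epowr (p * r / (p - r)) \<partial>\<sigma>)"
        by (intro add_mono mult_left_mono C(2)[rule_format]) auto
      also have "ennreal (\<epsilon> / C) * (ennreal C * (\<integral>\<^sup>+ x. f x epowr p \<partial>\<sigma>))
          = ennreal \<epsilon> * (\<integral>\<^sup>+ x. f x epowr p \<partial>\<sigma>)"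
        using C(1) \<epsilon> by (simp add: mult.assoc[symmetric] ennreal_mult[symmetric])
      finally show "(\<integral>\<^sup>+ x. T f x epowr r \<partial>\<sigma>) \<le> ennreal D * (\<integral>\<^sup>+ x. A x epowr (p * r / (p - r)) \<partial>\<sigma>)
          + ennreal \<epsilon> * (\<integral>\<^sup>+ x. f x epowr p \<partial>\<sigma>)" by (simp add: add.commute)
    qed
  qed
qed

end

section \<open>The weighted norm inequality\<close>

lemma e2ennreal_abs_diff_le: "e2ennreal \<bar>enn2ereal u - enn2ereal v\<bar> \<le> u + v"
proof (cases "u = top \<or> v = top")
  case False
  then obtain x y where "u = ennreal x" "0 \<le> x" "v = ennreal y" "0 \<le> y"
    by (cases u; cases v) auto
  then show ?thesis
    by (simp add: enn2ereal_ennreal e2ennreal_ereal ennreal_leI flip: ennreal_plus)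
qed auto

lemma wpotential_cong: "(\<And>y. f y = g y) \<Longrightarrow> wpotential G \<sigma> f x = wpotential G \<sigma> g x"
  by (simp add: wpotential_def)

lemma abs_spotential_nonneg:
  assumes "\<And>x. g x < top"
  shows "e2ennreal \<bar>spotential G \<sigma> (\<lambda>x. enn2real (g x)) x\<bar> = wpotential G \<sigma> g x"
proof -
  have "wpotential G \<sigma> (\<lambda>y. ennreal (- enn2real (g y))) x = 0"
    by (simp add: wpotential_def ennreal_neg)
  moreover have "wpotential G \<sigma> (\<lambda>y. ennreal (enn2real (g y))) x = wpotential G \<sigma> g x"
    using assms by (intro wpotential_cong) simp
  ultimately show ?thesis
    by (simp add: spotential_def zero_ennreal.rep_eq)
qed

lemma weighted_norm_inequality_nonneg:
  assumes W: "weighted_norm_inequality G \<sigma> p r" and pr: "0 < p" "0 < r"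
  obtains C :: real where "0 < C"
    "\<forall>g. g \<in> borel_measurable \<sigma> \<longrightarrow> (\<forall>x. g x < top) \<longrightarrow> (\<integral>\<^sup>+ x. g x epowr p \<partial>\<sigma>) < top \<longrightarrow>
      (\<integral>\<^sup>+ x. wpotential G \<sigma> g x epowr r \<partial>\<sigma>) \<le> ennreal C * (\<integral>\<^sup>+ x. g x epowr p \<partial>\<sigma>) epowr (r / p)"
proof -
  obtain C where C: "0 < C" "\<And>f. in_Lp \<sigma> p f \<Longrightarrow> Lnorm \<sigma> r (\<lambda>x. e2ennreal \<bar>spotential G \<sigma> f x\<bar>)
             \<le> ennreal C * Lnorm \<sigma> p (\<lambda>x. ennreal \<bar>f x\<bar>)"
    using W unfolding weighted_norm_inequality_def by blast
  show ?thesis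
  proof (rule that[of "C powr r"])
    show "0 < C powr r" using C by simp
    show "\<forall>g. g \<in> borel_measurable \<sigma> \<longrightarrow> (\<forall>x. g x < top) \<longrightarrow> (\<integral>\<^sup>+ x. g x epowr p \<partial>\<sigma>) < top \<longrightarrow>
      (\<integral>\<^sup>+ x. wpotential G \<sigma> g x epowr r \<partial>\<sigma>)
        \<le> ennreal (C powr r) * (\<integral>\<^sup>+ x. g x epowr p \<partial>\<sigma>) epowr (r / p)"
    proof (intro allI impI)
      fix g :: "'a \<Rightarrow> ennreal"
      assume g [measurable]: "g \<in> borel_measurable \<sigma>" and g_fin: "\<forall>x. g x < top"
        and fin: "(\<integral>\<^sup>+ x. g x epowr p \<partial>\<sigma>) < top"
      have L: "Lnorm \<sigma> p (\<lambda>x. ennreal \<bar>enn2real (g x)\<bar>) = (\<integral>\<^sup>+ x. g x epowr p \<partial>\<sigma>) epowr (1 / p)"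
        "Lnorm \<sigma> p g = (\<integral>\<^sup>+ x. g x epowr p \<partial>\<sigma>) epowr (1 / p)"
        using g_fin by (simp_all add: Lnorm_def)
      have "in_Lp \<sigma> p (\<lambda>x. enn2real (g x))"
        unfolding in_Lp_def L(1) using fin pr by simp
      then have "Lnorm \<sigma> r (wpotential G \<sigma> g)
          \<le> ennreal C * (\<integral>\<^sup>+ x. g x epowr p \<partial>\<sigma>) epowr (1 / p)"
        using C(2)[of "\<lambda>x. enn2real (g x)"] abs_spotential_nonneg[of g G \<sigma>] g_fin by (simp add: L)
      then have "Lnorm \<sigma> r (wpotential G \<sigma> g) epowr r
          \<le> (ennreal C * (\<integral>\<^sup>+ x. g x epowr p \<partial>\<sigma>) epowr (1 / p)) epowr r"
        using pr(2) by (rule epowr_mono)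
      then show "(\<integral>\<^sup>+ x. wpotential G \<sigma> g x epowr r \<partial>\<sigma>)
          \<le> ennreal (C powr r) * (\<integral>\<^sup>+ x. g x epowr p \<partial>\<sigma>) epowr (r / p)"
        using pr C(1) unfolding Lnorm_def by (simp add: epowr_epowr epowr_mult ennreal_epowr)
    qed
  qed
qed

lemma bound_from_sublinear:
  fixes x c :: ennreal
  assumes "x \<le> c * x epowr \<theta>" "x < top" "0 < \<theta>" "\<theta> < 1"
  shows "x \<le> c epowr (1 / (1 - \<theta>))"
proof (cases "x = 0")
  case False
  have "x epowr (1 - \<theta>) * x epowr \<theta> \<le> c * x epowr \<theta>"
    using assms epowr_add[of "1 - \<theta>" \<theta> x] by simp
  then have "x epowr (1 - \<theta>) \<le> c"
    using False assms ennreal_mult_le_mult_iff[of "x epowr \<theta>" "x epowr (1 - \<theta>)" c]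
    by (auto simp: mult.commute[of _ "x epowr \<theta>"])
  then show ?thesis using assms by (simp add: epowr_le_iff)
qed simp

context wmp_kernel
begin

lemma weighted_norm_inequality_if:
  assumes pr: "0 < r" "r < p" "1 < p" and A_pos: "\<And>x. 0 < A x"
    and fin: "(\<integral>\<^sup>+ x. A x epowr (p * r / (p - r)) \<partial>\<sigma>) < top"
  shows "weighted_norm_inequality G \<sigma> p r"
proof -
  obtain D :: ennreal where D: "D < top" "\<forall>f. f \<in> borel_measurable \<sigma> \<longrightarrow>
       (\<integral>\<^sup>+ x. T f x epowr r \<partial>\<sigma>) \<le> D + ennreal 1 * (\<integral>\<^sup>+ x. f x epowr p \<partial>\<sigma>)"
    by (rule T_power_integral_le[OF pr zero_less_one A_pos fin]) (rule that)
  obtain c where c: "D + 1 = ennreal c" "0 \<le> c" using D(1) by (cases "D + 1") auto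
  have "1 \<le> c"
  proof -
    have "ennreal 1 \<le> ennreal c" unfolding c(1)[symmetric] by simp
    then show ?thesis using c(2) by simp
  qed
  have "Lnorm \<sigma> r (\<lambda>x. e2ennreal \<bar>spotential G \<sigma> f x\<bar>)
          \<le> ennreal (c powr (1 / r)) * Lnorm \<sigma> p (\<lambda>x. ennreal \<bar>f x\<bar>)" if f: "in_Lp \<sigma> p f" for f
  proof -
    have [measurable]: "f \<in> borel_measurable \<sigma>" using f by (simp add: in_Lp_def)
    define g where "g x = ennreal \<bar>f x\<bar>" for x
    have g [measurable]: "g \<in> borel_measurable \<sigma>" unfolding g_def by measurable
    define \<Lambda> where "\<Lambda> = (\<integral>\<^sup>+ x. g x epowr p \<partial>\<sigma>) epowr (1 / p)"
    have \<Lambda>p: "\<Lambda> epowr p = (\<integral>\<^sup>+ x. g x epowr p \<partial>\<sigma>)"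
      using pr by (simp add: \<Lambda>_def epowr_epowr)
    have \<Lambda>_fin: "\<Lambda> < top" using f by (simp add: in_Lp_def Lnorm_def \<Lambda>_def g_def)
    have "e2ennreal \<bar>spotential G \<sigma> f x\<bar> \<le> T g x" for x
    proof -
      have "e2ennreal \<bar>spotential G \<sigma> f x\<bar> \<le> T (\<lambda>y. ennreal (f y)) x + T (\<lambda>y. ennreal (- f y)) x"
        unfolding spotential_def by (rule e2ennreal_abs_diff_le)
      also have "\<dots> = T (\<lambda>y. ennreal (f y) + ennreal (- f y)) x" by (rule T_add[symmetric]) auto
      also have "\<dots> = T g x"
        by (rule wpotential_cong) (auto simp: g_def abs_if ennreal_neg)
      finally show ?thesis .
    qed
    then have "(\<integral>\<^sup>+ x. e2ennreal \<bar>spotential G \<sigma> f x\<bar> epowr r \<partial>\<sigma>) \<le> (\<integral>\<^sup>+ x. T g x epowr r \<partial>\<sigma>)"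
      using pr by (intro nn_integral_mono epowr_mono) auto
    also have "\<dots> \<le> \<Lambda> epowr r * ennreal c"
    proof (cases "\<Lambda> = 0")
      case True
      then have "(\<integral>\<^sup>+ x. g x epowr p \<partial>\<sigma>) = 0" using \<Lambda>p by simp
      then have "AE x in \<sigma>. g x = 0"
        using pr by (subst (asm) nn_integral_0_iff_AE) auto
      then have "T g x = T (\<lambda>_. 0) x" for x by (rule T_cong_AE)
      then show ?thesis by (simp add: wpotential_def)
    next
      case False
      let ?f = "\<lambda>x. g x / \<Lambda>"
      have g_eq: "g x = \<Lambda> * ?f x" for x
        using False \<Lambda>_fin by (simp add: ennreal_mult_divide_cancel zero_less_iff_neq_zero)
      have "\<Lambda> epowr p * 1 = \<Lambda> epowr p * (\<integral>\<^sup>+ x. ?f x epowr p \<partial>\<sigma>)"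
      proof -
        have "\<Lambda> epowr p * 1 = (\<integral>\<^sup>+ x. (\<Lambda> * ?f x) epowr p \<partial>\<sigma>)"
          unfolding g_eq[symmetric] by (simp add: \<Lambda>p)
        also have "\<dots> = \<Lambda> epowr p * (\<integral>\<^sup>+ x. ?f x epowr p \<partial>\<sigma>)"
          using pr by (simp add: epowr_mult nn_integral_cmult)
        finally show ?thesis .
      qed
      then have 1: "(\<integral>\<^sup>+ x. ?f x epowr p \<partial>\<sigma>) = 1"
        using False \<Lambda>_fin pr unfolding ennreal_mult_cancel_left by auto
      have "(\<integral>\<^sup>+ x. T ?f x epowr r \<partial>\<sigma>) \<le> D + ennreal 1 * (\<integral>\<^sup>+ x. ?f x epowr p \<partial>\<sigma>)"
        by (rule D(2)[rule_format]) measurable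
      then have 2: "(\<integral>\<^sup>+ x. T ?f x epowr r \<partial>\<sigma>) \<le> ennreal c"
        unfolding 1 by (simp add: c(1))
      have "T g x = \<Lambda> * T ?f x" for x
      proof -
        have "T g x = T (\<lambda>y. \<Lambda> * ?f y) x" by (rule wpotential_cong[OF g_eq])
        also have "\<dots> = \<Lambda> * T ?f x" by (rule T_cmult) measurable
        finally show ?thesis .
      qed
      then have "(\<integral>\<^sup>+ x. T g x epowr r \<partial>\<sigma>) = \<Lambda> epowr r * (\<integral>\<^sup>+ x. T ?f x epowr r \<partial>\<sigma>)"
        using pr by (simp add: epowr_mult nn_integral_cmult)
      then show ?thesis using 2 by (simp add: mult_left_mono)
    qed
    finally have "Lnorm \<sigma> r (\<lambda>x. e2ennreal \<bar>spotential G \<sigma> f x\<bar>) \<le> (\<Lambda> epowr r * ennreal c) epowr (1 / r)"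
      unfolding Lnorm_def using pr by (intro epowr_mono) auto
    also have "\<dots> = ennreal (c powr (1 / r)) * \<Lambda>"
      using pr c(2) by (simp add: epowr_mult epowr_epowr ennreal_epowr mult.commute)
    finally show ?thesis by (simp add: \<Lambda>_def Lnorm_def g_def)
  qed
  moreover have "0 < c powr (1 / r)" using \<open>1 \<le> c\<close> by simp
  ultimately show ?thesis unfolding weighted_norm_inequality_def by blast
qed

lemma A_pos:
  assumes "emeasure \<sigma> UNIV \<noteq> 0"
  shows "0 < A x"
proof (rule T_pos)
  show "\<not> (AE y in \<sigma>. (1 :: ennreal) = 0)"
    using assms AE_iff_measurable[of UNIV \<sigma> "\<lambda>y. (1 :: ennreal) = 0"] by auto
qed simp

lemma A_eq_SUP:
  assumes "\<forall>n. F n \<in> sets borel" "incseq F" "AE x in \<sigma>. \<exists>n. x \<in> F n"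
  shows "A x = (SUP n. T (indicator (F n)) x)"
proof (rule T_SUP)
  note assms(1)[rule_format, measurable]
  show "indicator (F n) \<in> borel_measurable \<sigma>" for n by measurable
  have inc: "incseq (\<lambda>n. indicator (F n) y * (1 :: ennreal))" for y
    by (intro incseq_indicator_mult assms) auto
  then show "incseq (\<lambda>n. indicator (F n) y :: ennreal)" for y by simp
  show "AE y in \<sigma>. (1 :: ennreal) = (SUP n. indicator (F n) y)"
    using assms(3)
  proof (rule eventually_mono)
    fix y assume "\<exists>n. y \<in> F n"
    then obtain m where "y \<in> F m" by auto
    then show "(1 :: ennreal) = (SUP n. indicator (F n) y)"
      using SUP_indicator_mult[OF assms(2), of "\<lambda>_. 1" y m] by simp
  qed
qed

text \<open>
  On a good set \<open>F\<close> with \<open>b = T (indicator F)\<close>, test the inequality on \<open>b\<^sup>m\<close>, where \<open>m\<close>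
  is such that \<open>(b\<^sup>m)\<^sup>p = (b\<^sup>m\<^sup>+\<^sup>1)\<^sup>r\<close>; the power estimate for potentials gives
  \<open>b\<^sup>m\<^sup>+\<^sup>1 \<le> \<kappa> T (indicator F b\<^sup>m)\<close>.
\<close>

lemma power_A_integrable_if_weighted_norm_inequality:
  assumes W: "weighted_norm_inequality G \<sigma> p r" and pr: "0 < r" "r < p" "1 < p"
  shows "(\<integral>\<^sup>+ x. A x epowr (p * r / (p - r)) \<partial>\<sigma>) < top"
proof -
  have p0: "0 < p" using pr by simp
  obtain C :: real where C: "0 < C"
    "\<forall>g. g \<in> borel_measurable \<sigma> \<longrightarrow> (\<forall>x. g x < top) \<longrightarrow> (\<integral>\<^sup>+ x. g x epowr p \<partial>\<sigma>) < top \<longrightarrow>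
      (\<integral>\<^sup>+ x. T g x epowr r \<partial>\<sigma>) \<le> ennreal C * (\<integral>\<^sup>+ x. g x epowr p \<partial>\<sigma>) epowr (r / p)"
    by (rule weighted_norm_inequality_nonneg[OF W p0 pr(1)]) (rule that)
  interpret sigma_finite_measure \<sigma> by (rule sigma_finite)
  obtain k where k [measurable]: "k \<in> borel_measurable \<sigma>" and k_fin: "integral\<^sup>N \<sigma> k \<noteq> \<infinity>"
    and k_pos: "\<And>x. 0 < k x \<and> k x < \<infinity>"
    using Ex_finite_integrable_function by auto
  define w where "w x = k x epowr (1 / p)" for x
  have w [measurable]: "w \<in> borel_measurable \<sigma>" unfolding w_def by measurable
  have w_pos: "0 < w x" "w x < top" for x using k_pos[of x] p0 by (auto simp: w_def)
  have wp: "(\<integral>\<^sup>+ x. w x epowr p \<partial>\<sigma>) < top"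
    using k_fin p0 by (simp add: w_def epowr_epowr less_top)
  have "(\<integral>\<^sup>+ x. T w x epowr r \<partial>\<sigma>) \<le> ennreal C * (\<integral>\<^sup>+ x. w x epowr p \<partial>\<sigma>) epowr (r / p)"
    using C(2) w w_pos(2) wp by blast
  also have "\<dots> < top" using wp p0 pr by (simp add: ennreal_mult_less_top)
  finally have "AE x in \<sigma>. T w x < top"
    by (intro AE_less_top_if_power_integrable[OF _ pr(1)]) auto
  then obtain F where F: "\<forall>n. F n \<in> sets borel" "incseq F"
    "AE x in \<sigma>. \<exists>n. x \<in> F n" "\<forall>n. emeasure \<sigma> (F n) < top"
    "\<forall>n. \<forall>x\<in>F n. 1 \<le> of_nat n * w x"
    "\<forall>n. \<forall>x\<in>F n. T (indicator (F n)) x \<le> of_nat (n * n)"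
    by (rule good_exhaustion[rotated 2]) (use w_pos in auto)
  note F(1)[rule_format, measurable]
  define \<beta> where "\<beta> = p * r / (p - r)"
  define m where "m = r / (p - r)"
  have m: "0 < m" "m * p = \<beta>" "(1 + m) * r = \<beta>" "0 < \<beta>"
    using pr by (auto simp: m_def \<beta>_def field_simps)
  let ?c = "ennreal (\<kappa> (1 + m)) epowr r * ennreal C"
  have bound: "(\<integral>\<^sup>+ x. indicator (F n) x * T (indicator (F n)) x epowr \<beta> \<partial>\<sigma>) \<le> ?c epowr (1 / (1 - r / p))" for n
  proof -
    let ?b = "T (indicator (F n))"
    let ?X = "\<integral>\<^sup>+ x. indicator (F n) x * ?b x epowr \<beta> \<partial>\<sigma>"
    define g where "g x = indicator (F n) x * ?b x epowr m" for x
    have g [measurable]: "g \<in> borel_measurable \<sigma>" unfolding g_def by measurable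
    have b_le: "?b x \<le> of_nat (n * n)" if "x \<in> F n" for x using F(6) that by blast
    have "?X \<le> (\<integral>\<^sup>+ x. indicator (F n) x * of_nat (n * n) epowr \<beta> \<partial>\<sigma>)"
      using b_le m(4) by (intro nn_integral_mono) (auto simp: indicator_def intro: epowr_mono)
    also have "\<dots> < top"
      using F(4) m(4) by (subst nn_integral_multc) (auto simp: ennreal_mult_less_top of_nat_less_top)
    finally have fin: "?X < top" .
    have gX: "(\<integral>\<^sup>+ x. g x epowr p \<partial>\<sigma>) = ?X"
      using m p0 by (simp add: g_def epowr_indicator epowr_epowr)
    have g_fin: "g x < top" for x
    proof (cases "x \<in> F n")
      case True
      have "?b x < top" by (rule order_le_less_trans[OF b_le[OF True]]) (rule of_nat_less_top)
      then show ?thesis using m(1) by (simp add: g_def True)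
    qed (simp add: g_def)
    have "?X \<le> (\<integral>\<^sup>+ x. (ennreal (\<kappa> (1 + m)) * T g x) epowr r \<partial>\<sigma>)"
    proof (rule nn_integral_mono)
      fix x
      have "indicator (F n) x * ?b x epowr \<beta> \<le> (?b x epowr (1 + m)) epowr r"
        using m pr by (auto simp: indicator_def epowr_epowr)
      also have "?b x epowr (1 + m) \<le> ennreal (\<kappa> (1 + m)) * T g x"
        using T_power_le[of "indicator (F n)" "1 + m" x] m(1) unfolding g_def by simp
      finally show "indicator (F n) x * ?b x epowr \<beta> \<le> (ennreal (\<kappa> (1 + m)) * T g x) epowr r"
        using pr by (simp add: epowr_mono)
    qed
    also have "\<dots> = ennreal (\<kappa> (1 + m)) epowr r * (\<integral>\<^sup>+ x. T g x epowr r \<partial>\<sigma>)"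
      using pr by (simp add: epowr_mult nn_integral_cmult)
    also have "\<dots> \<le> ennreal (\<kappa> (1 + m)) epowr r * (ennreal C * ?X epowr (r / p))"
      using C(2)[rule_format, of g] g_fin fin unfolding gX by (intro mult_left_mono) auto
    finally have "?X \<le> ?c * ?X epowr (r / p)" by (simp add: mult.assoc)
    then show ?thesis by (rule bound_from_sublinear) (use fin pr in auto)
  qed
  have inc: "incseq (\<lambda>n. T (indicator (F n)) x epowr \<beta>)" for x
    unfolding incseq_def using incseqD[OF F(2)] m(4)
    by (intro allI impI epowr_mono T_mono) (auto simp: indicator_def)
  have "(\<integral>\<^sup>+ x. A x epowr \<beta> \<partial>\<sigma>)
      = (\<integral>\<^sup>+ x. (SUP n. indicator (F n) x * T (indicator (F n)) x epowr \<beta>) \<partial>\<sigma>)"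
    using F(3) SUP_indicator_mult[OF F(2) inc] m(4)
    by (intro nn_integral_cong_AE) (auto simp: A_eq_SUP[OF F(1-3)] epowr_SUP elim!: eventually_mono)
  also have "\<dots> = (SUP n. (\<integral>\<^sup>+ x. indicator (F n) x * T (indicator (F n)) x epowr \<beta> \<partial>\<sigma>))"
    using incseq_indicator_mult[OF F(2) inc]
    by (intro nn_integral_monotone_convergence_SUP) (auto simp: incseq_def le_fun_def)
  also have "\<dots> \<le> ?c epowr (1 / (1 - r / p))" by (intro SUP_least bound)
  also have "\<dots> < top" using pr by (simp add: ennreal_mult_less_top)
  finally show ?thesis unfolding \<beta>_def .
qed

section \<open>The sublinear integral equation\<close>

text \<open>
  The constant is the fixed point of \<open>c \<mapsto> c\<^sup>q / \<kappa>\<close>: if \<open>u \<ge> c b\<^sup>s\<close> with \<open>s = 1 / (1 - q)\<close>, then a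
  supersolution satisfies \<open>u \<ge> T (u\<^sup>q) \<ge> (c\<^sup>q / \<kappa>) b\<^sup>s\<close> by the power estimate.
\<close>

definition lower_const :: "real \<Rightarrow> real" where
  "lower_const q = (1 / \<kappa> (1 / (1 - q))) powr (1 / (1 - q))"

lemma lower_const_pos: "0 < lower_const q"
  using \<kappa>_pos[of "1 / (1 - q)"] by (simp add: lower_const_def)

lemma lower_const_fixed:
  assumes "0 < q" "q < 1"
  shows "lower_const q powr q / \<kappa> (1 / (1 - q)) = lower_const q"
proof -
  let ?k = "1 / \<kappa> (1 / (1 - q))"
  have k: "0 < ?k" using \<kappa>_pos[of "1 / (1 - q)"] by simp
  have "lower_const q powr q * ?k = ?k powr (1 / (1 - q) * q) * ?k powr 1"
    using k by (simp add: lower_const_def powr_powr)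
  also have "\<dots> = ?k powr (1 / (1 - q) * q + 1)" by (rule powr_add[symmetric])
  also have "1 / (1 - q) * q + 1 = 1 / (1 - q)" using assms by (simp add: field_simps)
  finally show ?thesis by (simp add: lower_const_def)
qed

lemma T_sublinear_power:
  assumes q: "0 < q" "q < 1" and c: "0 < c" and F [measurable]: "F \<in> sets borel"
  shows "ennreal (c powr q / \<kappa> (1 / (1 - q))) * T (indicator F) x epowr (1 / (1 - q))
    \<le> T (\<lambda>y. indicator F y * (ennreal c * T (indicator F) y epowr (1 / (1 - q))) epowr q) x"
proof -
  let ?b = "T (indicator F)" and ?s = "1 / (1 - q)"
  have s: "1 < ?s" "?s * q = ?s - 1" using q by (auto simp: field_simps)
  have m [measurable]: "?b \<in> borel_measurable \<sigma>" by measurable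
  have "ennreal (c powr q / \<kappa> ?s) * ?b x epowr ?s
      \<le> ennreal (c powr q / \<kappa> ?s) * (ennreal (\<kappa> ?s) * T (\<lambda>y. indicator F y * ?b y epowr (?s - 1)) x)"
    by (intro mult_left_mono T_power_le s) auto
  also have "\<dots> = ennreal (c powr q) * T (\<lambda>y. indicator F y * ?b y epowr (?s - 1)) x"
    using \<kappa>_pos[of ?s] by (simp add: mult.assoc[symmetric] ennreal_mult[symmetric])
  also have "\<dots> = T (\<lambda>y. ennreal (c powr q) * (indicator F y * ?b y epowr (?s - 1))) x"
    by (rule T_cmult[symmetric]) measurable
  also have "\<dots> = T (\<lambda>y. indicator F y * (ennreal c * ?b y epowr ?s) epowr q) x"
    using q c s by (intro wpotential_cong) (simp add: epowr_mult ennreal_epowr epowr_epowr ac_simps)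
  finally show ?thesis .
qed

text \<open>
  Starting from any positive constant, the improvement \<open>c \<mapsto> c\<^sup>q / \<kappa>\<close> converges to its fixed point.
  A first constant is available on good sets, where \<open>u\<close> is bounded below and \<open>b\<close> is bounded.
\<close>

lemma supersolution_lower_bound:
  assumes q: "0 < q" "q < 1" and u [measurable]: "u \<in> borel_measurable \<sigma>"
    and super: "AE x in \<sigma>. T (\<lambda>y. u y epowr q) x \<le> u x \<and> 0 < u x \<and> u x < top"
  shows "AE x in \<sigma>. ennreal (lower_const q) * A x epowr (1 / (1 - q)) \<le> u x"
proof -
  let ?s = "1 / (1 - q)" and ?c = "lower_const q"
  have s: "0 < ?s" using q by simp
  have c_pos: "0 < ?c" by (rule lower_const_pos)
  let ?w = "\<lambda>y. u y epowr q"
  have Tw: "AE x in \<sigma>. T ?w x < top"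
    using super by (rule eventually_mono) (blast intro: order_le_less_trans)
  have w_pos: "AE x in \<sigma>. 0 < ?w x"
    using super by (rule eventually_mono) (use q in simp)
  obtain F where F: "\<forall>n. F n \<in> sets borel" "incseq F"
    "AE x in \<sigma>. \<exists>n. x \<in> F n" "\<forall>n. emeasure \<sigma> (F n) < top"
    "\<forall>n. \<forall>x\<in>F n. 1 \<le> of_nat n * ?w x"
    "\<forall>n. \<forall>x\<in>F n. T (indicator (F n)) x \<le> of_nat (n * n)"
    by (rule good_exhaustion[OF _ w_pos Tw]) auto
  note F(1)[rule_format, measurable]
  have "AE x in \<sigma>. ennreal ?c * T (indicator (F n)) x epowr ?s \<le> u x" for n
  proof -
    let ?b = "T (indicator (F n))"
    have improve: "AE x in \<sigma>. ennreal (d powr q / \<kappa> ?s) * ?b x epowr ?s \<le> u x"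
      if d: "0 < d" and "AE x in \<sigma>. x \<in> F n \<longrightarrow> ennreal d * ?b x epowr ?s \<le> u x" for d
    proof -
      have le: "T (\<lambda>y. indicator (F n) y * (ennreal d * ?b y epowr ?s) epowr q) x \<le> T ?w x" for x
        using that(2) q
        by (intro T_mono_AE) (auto simp: indicator_def intro: epowr_mono elim!: eventually_mono)
      have "ennreal (d powr q / \<kappa> ?s) * ?b x epowr ?s \<le> T ?w x" for x
        using order_trans[OF T_sublinear_power[OF q d] le] by simp
      then show ?thesis using super by (auto intro: order_trans elim!: eventually_mono)
    qed
    obtain d where d: "0 < d" "\<And>x. x \<in> F n \<Longrightarrow> ennreal d * ?b x epowr ?s \<le> u x"
    proof (cases "n = 0")
      case True
      then have "F n = {}" using F(5) by fastforce
      then show ?thesis using that[of 1] by simp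
    next
      case False
      let ?\<delta> = "(1 / real n) powr (1 / q)" and ?B = "real (n * n) powr ?s"
      have B: "0 < ?B" "0 < ?\<delta>" using False by auto
      show ?thesis
      proof (rule that[of "?\<delta> / ?B"])
        show "0 < ?\<delta> / ?B" using B by simp
        fix x assume x: "x \<in> F n"
        have "?b x epowr ?s \<le> of_nat (n * n) epowr ?s" using F(6) x s by (intro epowr_mono) auto
        also have "\<dots> = ennreal ?B" by (simp add: ennreal_of_nat_eq_real_of_nat ennreal_epowr del: of_nat_mult)
        finally have "ennreal (?\<delta> / ?B) * ?b x epowr ?s \<le> ennreal (?\<delta> / ?B) * ennreal ?B"
          by (intro mult_left_mono) auto
        also have "\<dots> = ennreal ?\<delta>" using B by (simp add: ennreal_mult[symmetric])
        also have "\<dots> \<le> u x"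
        proof -
          have "ennreal (1 / real n) * 1 \<le> ennreal (1 / real n) * (of_nat n * ?w x)"
            using F(5) x by (intro mult_left_mono) auto
          also have "\<dots> = ennreal (1 / real n * real n) * ?w x"
            by (subst ennreal_mult) (auto simp: ennreal_of_nat_eq_real_of_nat mult.assoc)
          finally have "ennreal (1 / real n) \<le> ?w x" using False by simp
          then have "ennreal (1 / real n) epowr (1 / q) \<le> ?w x epowr (1 / q)"
            using q by (intro epowr_mono) auto
          then show ?thesis using q by (simp add: ennreal_epowr epowr_epowr)
        qed
        finally show "ennreal (?\<delta> / ?B) * ?b x epowr ?s \<le> u x" .
      qed
    qed
    \<comment> \<open>The iterates of \<open>d\<close> in closed form.\<close>
    define e where "e k = ?c * (d / ?c) powr (q ^ k)" for k
    have e_pos: "0 < e k" for k using d(1) c_pos by (simp add: e_def)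
    have e_Suc: "e (Suc k) = e k powr q / \<kappa> ?s" for k
    proof -
      have "e k powr q = ?c powr q * (d / ?c) powr (q ^ k * q)"
        using d(1) c_pos by (simp add: e_def powr_mult powr_powr)
      then have "e k powr q / \<kappa> ?s = (?c powr q / \<kappa> ?s) * (d / ?c) powr (q ^ Suc k)"
        by (simp add: mult.commute)
      then show ?thesis unfolding lower_const_fixed[OF q] e_def by simp
    qed
    have step: "AE x in \<sigma>. x \<in> F n \<longrightarrow> ennreal (e k) * ?b x epowr ?s \<le> u x" for k
    proof (induction k)
      case 0
      have "e 0 = d" using d(1) c_pos by (simp add: e_def)
      then show ?case using d(2) by simp
    next
      case (Suc k)
      show ?case using improve[OF e_pos Suc] unfolding e_Suc by (auto elim!: eventually_mono)
    qed
    have "AE x in \<sigma>. \<forall>k. ennreal (e (Suc k)) * ?b x epowr ?s \<le> u x"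
      unfolding AE_all_countable e_Suc using improve[OF e_pos step] by blast
    then show ?thesis
    proof (rule eventually_mono)
      fix x assume le: "\<forall>k. ennreal (e (Suc k)) * ?b x epowr ?s \<le> u x"
      have "(\<lambda>k. q ^ k) \<longlonglongrightarrow> 0" using q by (intro LIMSEQ_realpow_zero) auto
      then have "(\<lambda>k. ?c * (d / ?c) powr (q ^ k)) \<longlonglongrightarrow> ?c * (d / ?c) powr 0"
        using d(1) c_pos q by (intro tendsto_intros) auto
      then have "e \<longlonglongrightarrow> ?c" using d(1) c_pos by (simp add: e_def[abs_def])
      then have "(\<lambda>k. ennreal (e (Suc k))) \<longlonglongrightarrow> ennreal ?c"
        by (intro tendsto_ennrealI) (rule LIMSEQ_Suc)
      then have "(\<lambda>k. ennreal (e (Suc k)) * ?b x epowr ?s) \<longlonglongrightarrow> ennreal ?c * ?b x epowr ?s"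
        using c_pos by (intro tendsto_mult_ennreal tendsto_const) auto
      then show "ennreal ?c * ?b x epowr ?s \<le> u x"
        by (rule LIMSEQ_le_const2) (use le in auto)
    qed
  qed
  then have "AE x in \<sigma>. \<forall>n. ennreal ?c * T (indicator (F n)) x epowr ?s \<le> u x"
    by (simp add: AE_all_countable)
  then show ?thesis
  proof (rule eventually_mono)
    fix x assume "\<forall>n. ennreal ?c * T (indicator (F n)) x epowr ?s \<le> u x"
    then show "ennreal ?c * A x epowr ?s \<le> u x"
      using s by (simp add: A_eq_SUP[OF F(1-3)] epowr_SUP SUP_mult_left_ennreal SUP_le_iff)
  qed
qed

lemma power_A_integrable_if_supersolution:
  assumes q: "0 < q" "q < 1" "q < r" and u: "in_Lp_nonneg \<sigma> r u" "positive_supersolution G \<sigma> q u"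
  shows "(\<integral>\<^sup>+ x. A x epowr (r / (1 - q)) \<partial>\<sigma>) < top"
proof -
  let ?c = "lower_const q"
  have c: "0 < ?c" by (rule lower_const_pos)
  have m: "u \<in> borel_measurable \<sigma>" and fin: "(\<integral>\<^sup>+ x. u x epowr r \<partial>\<sigma>) < top"
    using u(1) q by (auto simp: in_Lp_nonneg_def Lnorm_def)
  have "AE x in \<sigma>. ennreal ?c * A x epowr (1 / (1 - q)) \<le> u x"
    using supersolution_lower_bound[OF q(1,2) m] u(2) by (simp add: positive_supersolution_def)
  then have "(\<integral>\<^sup>+ x. (ennreal ?c * A x epowr (1 / (1 - q))) epowr r \<partial>\<sigma>) \<le> (\<integral>\<^sup>+ x. u x epowr r \<partial>\<sigma>)"
    using q by (intro nn_integral_mono_AE) (auto intro: epowr_mono elim!: eventually_mono)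
  also have "(\<integral>\<^sup>+ x. (ennreal ?c * A x epowr (1 / (1 - q))) epowr r \<partial>\<sigma>)
      = ennreal (?c powr r) * (\<integral>\<^sup>+ x. A x epowr (r / (1 - q)) \<partial>\<sigma>)"
    using q c by (simp add: epowr_mult epowr_epowr ennreal_epowr nn_integral_cmult)
  finally have "ennreal (?c powr r) * (\<integral>\<^sup>+ x. A x epowr (r / (1 - q)) \<partial>\<sigma>) < top"
    using fin by (rule order_le_less_trans)
  then show ?thesis using c by (auto simp: ennreal_mult_less_top)
qed

text \<open>
  The function \<open>c A\<^sup>s\<close> is a subsolution by the power estimate, so iterating \<open>u \<mapsto> T (u\<^sup>q)\<close> from it
  gives an increasing sequence. Its \<open>L\<^sup>r\<close> norms stay bounded because each step satisfies
  \<open>X\<^sub>k\<^sub>+\<^sub>1 \<le> D + X\<^sub>k / 2\<close> for \<open>X\<^sub>k = \<integral> u\<^sub>k\<^sup>r\<close>.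
\<close>

lemma ex_positive_solution:
  assumes q: "0 < q" "q < 1" "q < r" and A_pos: "\<And>x. 0 < A x"
    and fin: "(\<integral>\<^sup>+ x. A x epowr (r / (1 - q)) \<partial>\<sigma>) < top"
  shows "\<exists>u. in_Lp_nonneg \<sigma> r u \<and> positive_solution G \<sigma> q u"
proof -
  let ?s = "1 / (1 - q)" and ?c = "lower_const q"
  have s: "0 < ?s" using q by simp
  have c: "0 < ?c" by (rule lower_const_pos)
  define v where "v = rec_nat (\<lambda>x. ennreal ?c * A x epowr ?s) (\<lambda>_ w. T (\<lambda>y. w y epowr q))"
  have v0: "v 0 = (\<lambda>x. ennreal ?c * A x epowr ?s)" and vS: "v (Suc k) = T (\<lambda>y. v k y epowr q)" for k
    by (simp_all add: v_def)
  have v_meas [measurable]: "v k \<in> borel_measurable \<sigma>" for k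
  proof (induction k)
    case 0
    then show ?case unfolding v0 by measurable
  next
    case (Suc k)
    note Suc [measurable]
    show ?case unfolding vS by measurable
  qed
  have v_Suc: "v k x \<le> v (Suc k) x" for k x
  proof (induction k arbitrary: x)
    case 0
    have A: "T (indicator UNIV) = A" by (intro ext wpotential_cong) simp
    show ?case
      using T_sublinear_power[OF q(1,2) c, of UNIV x]
      by (simp add: vS v0 A lower_const_fixed[OF q(1,2)])
  next
    case (Suc k)
    then show ?case unfolding vS[of "Suc k"] vS[of k] using q by (intro T_mono epowr_mono) (auto simp: vS)
  qed
  have inc: "incseq (\<lambda>k. v k x)" for x by (intro incseq_SucI v_Suc)
  define u where "u x = (SUP k. v k x)" for x
  have u [measurable]: "u \<in> borel_measurable \<sigma>" unfolding u_def by measurable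
  have p: "r < r / q" "1 < r / q" "0 < r" using q by (auto simp: field_simps)
  have exponent: "(r / q) * r / (r / q - r) = r / (1 - q)"
    using q by (simp add: field_simps)
  obtain D :: ennreal where D: "D < top" "\<forall>f. f \<in> borel_measurable \<sigma> \<longrightarrow>
       (\<integral>\<^sup>+ x. T f x epowr r \<partial>\<sigma>) \<le> D + ennreal (1 / 2) * (\<integral>\<^sup>+ x. f x epowr (r / q) \<partial>\<sigma>)"
    by (rule T_power_integral_le[OF p(3,1,2) half_gt_zero[OF zero_less_one] A_pos fin[folded exponent]])
       (rule that)
  let ?X = "\<lambda>k. \<integral>\<^sup>+ x. v k x epowr r \<partial>\<sigma>"
  have X0: "?X 0 < top"
  proof -
    have "?X 0 = ennreal (?c powr r) * (\<integral>\<^sup>+ x. A x epowr (r / (1 - q)) \<partial>\<sigma>)"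
      using q c by (simp add: v0 epowr_mult epowr_epowr ennreal_epowr nn_integral_cmult)
    then show ?thesis using fin by (simp add: ennreal_mult_less_top)
  qed
  have X: "?X k \<le> ?X 0 + 2 * D" for k
  proof (induction k)
    case (Suc k)
    have half: "ennreal (1 / 2) * (2 * y) = y" for y
    proof -
      have "ennreal (1 / 2) * (ennreal 2 * y) = ennreal (1 / 2 * 2) * y"
        by (subst ennreal_mult) (auto simp: mult.assoc)
      then show ?thesis by simp
    qed
    have "?X (Suc k) \<le> D + ennreal (1 / 2) * (\<integral>\<^sup>+ x. (v k x epowr q) epowr (r / q) \<partial>\<sigma>)"
      unfolding vS by (rule D(2)[rule_format]) measurable
    also have "\<dots> = D + ennreal (1 / 2) * ?X k"
      using q by (simp add: epowr_epowr)
    also have "\<dots> \<le> D + ennreal (1 / 2) * (?X 0 + 2 * D)"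
      by (intro add_left_mono mult_left_mono Suc) auto
    also have "\<dots> = D + (ennreal (1 / 2) * ?X 0 + D)"
      by (simp only: distrib_left half)
    also have "\<dots> \<le> D + (?X 0 + D)"
    proof (intro add_left_mono add_right_mono)
      have "ennreal (1 / 2) * ?X 0 \<le> ennreal 1 * ?X 0" by (intro mult_right_mono ennreal_leI) auto
      then show "ennreal (1 / 2) * ?X 0 \<le> ?X 0" by simp
    qed
    also have "\<dots> = ?X 0 + 2 * D" unfolding mult_2 by (simp only: ac_simps)
    finally show ?case .
  qed (simp add: add_increasing2)
  have "(\<integral>\<^sup>+ x. u x epowr r \<partial>\<sigma>) = (\<integral>\<^sup>+ x. (SUP k. v k x epowr r) \<partial>\<sigma>)"
    unfolding u_def using p(3) by (simp add: epowr_SUP)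
  also have "\<dots> = (SUP k. ?X k)"
    using inc p(3) by (intro nn_integral_monotone_convergence_SUP)
      (auto simp: incseq_def le_fun_def intro: epowr_mono)
  also have "\<dots> \<le> ?X 0 + 2 * D" by (intro SUP_least X)
  also have "\<dots> < top" using X0 D(1) by (simp add: ennreal_mult_less_top)
  finally have u_fin: "(\<integral>\<^sup>+ x. u x epowr r \<partial>\<sigma>) < top" .
  have eq: "T (\<lambda>y. u y epowr q) x = u x" for x
  proof -
    have "T (\<lambda>y. u y epowr q) x = (SUP k. v (Suc k) x)"
      unfolding vS u_def using q inc
      by (intro T_SUP) (auto simp: epowr_SUP incseq_def intro: epowr_mono)
    also have "\<dots> = u x"
      unfolding u_def
      by (rule antisym) (auto intro!: SUP_least intro: SUP_upper SUP_upper2 v_Suc)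
    finally show ?thesis .
  qed
  have u_pos: "0 < u x" for x
  proof -
    have "0 < v 0 x" using A_pos[of x] c s by (simp add: v0 ennreal_zero_less_mult_iff)
    also have "\<dots> \<le> u x" unfolding u_def by (rule SUP_upper) simp
    finally show ?thesis .
  qed
  have "AE x in \<sigma>. u x < top"
    by (rule AE_less_top_if_power_integrable[OF u p(3) u_fin])
  then have "positive_solution G \<sigma> q u"
    unfolding positive_solution_def using eq u_pos by (auto elim!: eventually_mono)
  moreover have "in_Lp_nonneg \<sigma> r u"
    using u u_fin p(3) by (simp add: in_Lp_nonneg_def Lnorm_def)
  ultimately show ?thesis by blast
qed

end

section \<open>The characterizations\<close>

lemma radon_nonzero_compact:
  assumes "radon_measure \<sigma>" "emeasure \<sigma> UNIV \<noteq> 0"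
  obtains K where "compact K" "0 < emeasure \<sigma> K"
proof -
  have "0 < (SUP K\<in>{K. compact K \<and> K \<subseteq> UNIV}. emeasure \<sigma> K)"
    using assms(2) unfolding radon_inner_regular_open[OF assms(1) open_UNIV]
    by (simp add: zero_less_iff_neq_zero)
  then show ?thesis using that unfolding less_SUP_iff by auto
qed

text \<open>
  A compact set of positive measure has a potential that is positive everywhere, so integrability
  of one of its powers exhausts the space by sets of finite measure. Both the norm inequality and
  the integrability of a power of the potential of \<open>\<sigma>\<close> provide this; for a supersolution \<open>u\<close>,
  the function \<open>u\<^sup>r\<close> itself plays this role.
\<close>

lemma sigma_finite_if_potential_power_integrable:
  fixes G :: "'a::t2_space \<Rightarrow> 'a \<Rightarrow> ennreal" and \<sigma> :: "'a measure"
  assumes R: "radon_measure \<sigma>" and G: "lower_semicontinuous_kernel G" and pos: "\<And>x y. 0 < G x y"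
    and K: "compact K" "0 < emeasure \<sigma> K" and r: "0 < r"
    and fin: "(\<integral>\<^sup>+ x. wpotential G \<sigma> (indicator K) x epowr r \<partial>\<sigma>) < top"
  shows "sigma_finite_measure \<sigma>"
proof -
  let ?\<nu> = "density \<sigma> (indicator K)"
  note radon_sets [OF R, measurable_cong]
  have Kb [measurable]: "K \<in> sets borel" using K by (simp add: borel_compact)
  have m: "(indicator K :: 'a \<Rightarrow> ennreal) \<in> borel_measurable borel" by measurable
  have \<nu>: "radon_measure ?\<nu>" "emeasure ?\<nu> UNIV < \<infinity>"
    using radon_density_bounded[OF R K(1) m, of 1] by (auto simp: indicator_def)
  have eq: "wpotential G \<sigma> (indicator K) x = potential G ?\<nu> x" for x
    unfolding wpotential_def potential_def
    using borel_measurable_kernel[OF G, of x] R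
    by (subst nn_integral_density) (auto simp: ac_simps)
  have "wpotential G \<sigma> (indicator K) \<in> borel_measurable borel"
    unfolding eq[abs_def] by (rule lsc_imp_borel, rule potential_lsc[OF \<nu> G])
  then have [measurable]: "wpotential G \<sigma> (indicator K) \<in> borel_measurable \<sigma>"
    using R by simp
  have "\<not> (AE y in \<sigma>. (indicator K y :: ennreal) = 0)"
    using K(2) R Kb AE_iff_measurable[of K \<sigma> "\<lambda>y. (indicator K y :: ennreal) = 0"]
    by (auto simp: indicator_def)
  then have T_pos: "0 < wpotential G \<sigma> (indicator K) x" for x
    using R by (intro wpotential_pos[OF R G pos]) auto
  have "(\<lambda>x. wpotential G \<sigma> (indicator K) x epowr r) \<in> borel_measurable \<sigma>" by measurable
  moreover have "AE x in \<sigma>. 0 < wpotential G \<sigma> (indicator K) x epowr r" using T_pos r by simp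
  ultimately show ?thesis
    by (rule sigma_finite_if_positive_integrable) (use fin in simp)
qed

lemma sigma_finite_if_full_potential_power_integrable:
  fixes G :: "'a::t2_space \<Rightarrow> 'a \<Rightarrow> ennreal" and \<sigma> :: "'a measure"
  assumes R: "radon_measure \<sigma>" and lsc: "lower_semicontinuous_kernel G" and pos: "\<And>x y. 0 < G x y"
    and nz: "emeasure \<sigma> UNIV \<noteq> 0" and \<beta>: "0 < \<beta>"
    and fin: "(\<integral>\<^sup>+ x. potential G \<sigma> x epowr \<beta> \<partial>\<sigma>) < \<infinity>"
  shows "sigma_finite_measure \<sigma>"
proof -
  obtain K where K: "compact K" "0 < emeasure \<sigma> K" by (rule radon_nonzero_compact[OF R nz])
  have "wpotential G \<sigma> (indicator K) x \<le> potential G \<sigma> x" for x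
    unfolding wpotential_def potential_def by (intro nn_integral_mono) (auto simp: indicator_def)
  then have "(\<integral>\<^sup>+ x. wpotential G \<sigma> (indicator K) x epowr \<beta> \<partial>\<sigma>)
      \<le> (\<integral>\<^sup>+ x. potential G \<sigma> x epowr \<beta> \<partial>\<sigma>)"
    using \<beta> by (intro nn_integral_mono epowr_mono)
  also have "\<dots> < top" using fin by simp
  finally show ?thesis
    by (rule sigma_finite_if_potential_power_integrable[OF R lsc pos K \<beta>])
qed

text \<open>
  The zero measure is treated apart because the potential of \<open>\<sigma>\<close>, by which one divides above, then vanishes.
  In that case all the conditions hold trivially.
\<close>

lemma characterizations_zero_measure:
  assumes "emeasure \<sigma> (space \<sigma>) = 0"
  shows "(\<integral>\<^sup>+ x. f x \<partial>\<sigma>) = 0" "weighted_norm_inequality G \<sigma> p r"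
    "\<exists>u. in_Lp_nonneg \<sigma> r u \<and> positive_solution G \<sigma> q u"
proof -
  have ae: "AE x in \<sigma>. P x" for P
    using assms(1) by (intro AE_I[of _ _ "space \<sigma>"]) auto
  have int: "(\<integral>\<^sup>+ x. f x \<partial>\<sigma>) = 0" for f
    using nn_integral_cong_AE[OF ae, of f "\<lambda>_. 0"] by simp
  then show "(\<integral>\<^sup>+ x. f x \<partial>\<sigma>) = 0" .
  show "weighted_norm_inequality G \<sigma> p r"
    unfolding weighted_norm_inequality_def by (intro exI[of _ 1]) (simp add: Lnorm_def int)
  have "in_Lp_nonneg \<sigma> r (\<lambda>_. 0)" by (simp add: in_Lp_nonneg_def Lnorm_def)
  moreover have "positive_solution G \<sigma> q (\<lambda>_. 0)" unfolding positive_solution_def by (rule ae)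
  ultimately show "\<exists>u. in_Lp_nonneg \<sigma> r u \<and> positive_solution G \<sigma> q u" by blast
qed

lemma weighted_norm_inequality_iff:
  fixes G :: "'a::t2_space \<Rightarrow> 'a \<Rightarrow> ennreal" and \<sigma> :: "'a measure"
  assumes R: "radon_measure \<sigma>" and pos: "\<And>x y. 0 < G x y" and lsc: "lower_semicontinuous_kernel G"
    and kernel: "sigma_finite_measure \<sigma> \<longrightarrow> wmp_kernel G \<sigma> a h"
    and nz: "emeasure \<sigma> UNIV \<noteq> 0" and pr: "0 < r" "r < p" "1 < p"
  shows "weighted_norm_inequality G \<sigma> p r \<longleftrightarrow>
    (\<integral>\<^sup>+ x. potential G \<sigma> x epowr (p * r / (p - r)) \<partial>\<sigma>) < \<infinity>"
proof -
  have A_eq: "wpotential G \<sigma> (\<lambda>_. 1) = potential G \<sigma>"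
    by (simp add: wpotential_def potential_def fun_eq_iff)
  obtain K where K: "compact K" "0 < emeasure \<sigma> K" by (rule radon_nonzero_compact[OF R nz])
  have p0: "0 < p" using pr by simp
  show ?thesis
  proof
    assume W: "weighted_norm_inequality G \<sigma> p r"
    obtain C :: real where C: "0 < C"
      "\<forall>g. g \<in> borel_measurable \<sigma> \<longrightarrow> (\<forall>x. g x < top) \<longrightarrow> (\<integral>\<^sup>+ x. g x epowr p \<partial>\<sigma>) < top \<longrightarrow>
        (\<integral>\<^sup>+ x. wpotential G \<sigma> g x epowr r \<partial>\<sigma>) \<le> ennreal C * (\<integral>\<^sup>+ x. g x epowr p \<partial>\<sigma>) epowr (r / p)"
      by (rule weighted_norm_inequality_nonneg[OF W p0 pr(1)]) (rule that)
    have Kb: "K \<in> sets \<sigma>" using K R by (simp add: borel_compact)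
    have "(\<lambda>x. (indicator K x :: ennreal) epowr p) = indicator K"
      using p0 by (auto simp: indicator_def fun_eq_iff)
    then have Kp: "(\<integral>\<^sup>+ x. indicator K x epowr p \<partial>\<sigma>) = emeasure \<sigma> K" using Kb by simp
    have Kfin: "emeasure \<sigma> K < top" using radon_compact_finite[OF R K(1)] by simp
    have "(\<integral>\<^sup>+ x. wpotential G \<sigma> (indicator K) x epowr r \<partial>\<sigma>) \<le> ennreal C * emeasure \<sigma> K epowr (r / p)"
      using C(2)[rule_format, of "indicator K"] Kb Kfin unfolding Kp by (simp add: indicator_def)
    also have "\<dots> < top" using Kfin pr p0 by (simp add: ennreal_mult_less_top)
    finally have "sigma_finite_measure \<sigma>"
      by (rule sigma_finite_if_potential_power_integrable[OF R lsc pos K pr(1)])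
    then interpret wmp_kernel G \<sigma> a h by (rule kernel[rule_format])
    show "(\<integral>\<^sup>+ x. potential G \<sigma> x epowr (p * r / (p - r)) \<partial>\<sigma>) < \<infinity>"
      using power_A_integrable_if_weighted_norm_inequality[OF W pr] by (simp add: A_eq)
  next
    assume fin: "(\<integral>\<^sup>+ x. potential G \<sigma> x epowr (p * r / (p - r)) \<partial>\<sigma>) < \<infinity>"
    have "0 < p * r / (p - r)" using pr by simp
    then have "sigma_finite_measure \<sigma>"
      by (rule sigma_finite_if_full_potential_power_integrable[OF R lsc pos nz _ fin])
    then interpret wmp_kernel G \<sigma> a h by (rule kernel[rule_format])
    show "weighted_norm_inequality G \<sigma> p r"
      by (rule weighted_norm_inequality_if[OF pr A_pos[OF nz]]) (use fin in \<open>simp_all add: A_eq\<close>)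
  qed
qed

lemma positive_solution_imp_supersolution:
  "positive_solution G \<sigma> q u \<Longrightarrow> positive_supersolution G \<sigma> q u"
  unfolding positive_solution_def positive_supersolution_def by (auto elim!: eventually_mono)

lemma sublinear_equation_equivalences:
  fixes G :: "'a::t2_space \<Rightarrow> 'a \<Rightarrow> ennreal" and \<sigma> :: "'a measure"
  assumes R: "radon_measure \<sigma>" and pos: "\<And>x y. 0 < G x y" and lsc: "lower_semicontinuous_kernel G"
    and kernel: "sigma_finite_measure \<sigma> \<longrightarrow> wmp_kernel G \<sigma> a h"
    and nz: "emeasure \<sigma> UNIV \<noteq> 0" and q: "0 < q" "q < 1" "q < r"
  shows "in_Lp_nonneg \<sigma> r u \<Longrightarrow> positive_supersolution G \<sigma> q u \<Longrightarrow>
      (\<integral>\<^sup>+ x. potential G \<sigma> x epowr (r / (1 - q)) \<partial>\<sigma>) < \<infinity>"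
    and "(\<integral>\<^sup>+ x. potential G \<sigma> x epowr (r / (1 - q)) \<partial>\<sigma>) < \<infinity> \<Longrightarrow>
      \<exists>u. in_Lp_nonneg \<sigma> r u \<and> positive_solution G \<sigma> q u"
proof -
  have A_eq: "wpotential G \<sigma> (\<lambda>_. 1) = potential G \<sigma>"
    by (simp add: wpotential_def potential_def fun_eq_iff)
  have r: "0 < r" using q by simp
  show "(\<integral>\<^sup>+ x. potential G \<sigma> x epowr (r / (1 - q)) \<partial>\<sigma>) < \<infinity>"
    if u: "in_Lp_nonneg \<sigma> r u" "positive_supersolution G \<sigma> q u"
  proof -
    have m: "u \<in> borel_measurable \<sigma>" and fin: "(\<integral>\<^sup>+ x. u x epowr r \<partial>\<sigma>) < \<infinity>"
      using u(1) r by (auto simp: in_Lp_nonneg_def Lnorm_def)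
    have "AE x in \<sigma>. 0 < u x epowr r"
      using u(2) r by (auto simp: positive_supersolution_def elim!: eventually_mono)
    then have "sigma_finite_measure \<sigma>"
      by (intro sigma_finite_if_positive_integrable[OF _ _ fin]) (use m in measurable)
    then interpret wmp_kernel G \<sigma> a h by (rule kernel[rule_format])
    show ?thesis using power_A_integrable_if_supersolution[OF q u] by (simp add: A_eq)
  qed
  show "\<exists>u. in_Lp_nonneg \<sigma> r u \<and> positive_solution G \<sigma> q u"
    if fin: "(\<integral>\<^sup>+ x. potential G \<sigma> x epowr (r / (1 - q)) \<partial>\<sigma>) < \<infinity>"
  proof -
    have "0 < r / (1 - q)" using q by simp
    then have "sigma_finite_measure \<sigma>"
      by (rule sigma_finite_if_full_potential_power_integrable[OF R lsc pos nz _ fin])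
    then interpret wmp_kernel G \<sigma> a h by (rule kernel[rule_format])
    show ?thesis using fin by (intro ex_positive_solution[OF q A_pos[OF nz]]) (simp add: A_eq)
  qed
qed

theorem theorem1p1:
  fixes G :: "'a::t2_space \<Rightarrow> 'a \<Rightarrow> ennreal" and \<sigma> :: "'a measure"
  assumes "locally_compact_space (euclidean :: 'a topology)"
    and "radon_measure \<sigma>"
    and "\<And>x y. 0 < G x y"
    and "quasi_symmetric G"
    and "lower_semicontinuous_kernel G"
    and "weak_maximum_principle G"
  shows "(\<forall>p r::real. 1 < p \<and> 0 < r \<and> r < p \<longrightarrow>
            (weighted_norm_inequality G \<sigma> p r \<longleftrightarrow>
             (\<integral>\<^sup>+ x. potential G \<sigma> x epowr (p * r / (p - r)) \<partial>\<sigma>) < \<infinity>)) \<and>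
         (\<forall>q r::real. 0 < q \<and> q < 1 \<and> q < r \<longrightarrow>
            ((\<exists>u. in_Lp_nonneg \<sigma> r u \<and> positive_supersolution G \<sigma> q u) \<longleftrightarrow>
             (\<exists>u. in_Lp_nonneg \<sigma> r u \<and> positive_solution G \<sigma> q u)) \<and>
            ((\<exists>u. in_Lp_nonneg \<sigma> r u \<and> positive_solution G \<sigma> q u) \<longleftrightarrow>
             weighted_norm_inequality G \<sigma> (r / q) r) \<and>
            (weighted_norm_inequality G \<sigma> (r / q) r \<longleftrightarrow>
             (\<integral>\<^sup>+ x. potential G \<sigma> x epowr (r / (1 - q)) \<partial>\<sigma>) < \<infinity>))"
proof (cases "emeasure \<sigma> UNIV = 0")
  case True
  then have z: "emeasure \<sigma> (space \<sigma>) = 0" using assms(2) by simp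
  have "\<exists>u. in_Lp_nonneg \<sigma> r u \<and> positive_supersolution G \<sigma> q u" for q r
    using characterizations_zero_measure(3)[OF z] positive_solution_imp_supersolution by blast
  then show ?thesis
    using characterizations_zero_measure[OF z] by (intro conjI allI impI iffI) simp_all
next
  case nz: False
  obtain a :: real where a: "0 < a" "\<And>x y. G x y \<le> ennreal a * G y x"
    using assms(4) unfolding quasi_symmetric_def by blast
  obtain h :: real where h: "1 \<le> h"
    "\<And>\<nu> M. radon_measure \<nu> \<Longrightarrow> 0 < M \<Longrightarrow> (SUP x\<in>msupp \<nu>. potential G \<nu> x) \<le> ennreal M \<Longrightarrow>
       (SUP x. potential G \<nu> x) \<le> ennreal (h * M)"
    using assms(6) unfolding weak_maximum_principle_def by blast
  have "wmp_kernel G \<sigma> a h" if "sigma_finite_measure \<sigma>"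
  proof (rule wmp_kernel.intro)
    show "potential G \<nu> x \<le> ennreal (h * M)"
      if "radon_measure \<nu>" "0 < M" "\<forall>y\<in>msupp \<nu>. potential G \<nu> y \<le> ennreal M" for \<nu> M x
    proof -
      have "potential G \<nu> x \<le> (SUP x. potential G \<nu> x)" by (rule SUP_upper) simp
      also have "\<dots> \<le> ennreal (h * M)" using that by (intro h(2) SUP_least) auto
      finally show ?thesis .
    qed
  qed (fact assms(2,3,5) a h(1) that)+
  then have kernel: "sigma_finite_measure \<sigma> \<longrightarrow> wmp_kernel G \<sigma> a h" by blast
  note iff = weighted_norm_inequality_iff[OF assms(2,3,5) kernel nz]
  show ?thesis
  proof (rule conjI; intro allI impI)
    fix p r :: real
    assume "1 < p \<and> 0 < r \<and> r < p"
    then show "weighted_norm_inequality G \<sigma> p r \<longleftrightarrow>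
        (\<integral>\<^sup>+ x. potential G \<sigma> x epowr (p * r / (p - r)) \<partial>\<sigma>) < \<infinity>"
      using iff[of r p] by blast
  next
    fix q r :: real
    assume qr: "0 < q \<and> q < 1 \<and> q < r"
    then have q: "0 < q" "q < 1" "q < r" by auto
    have p: "0 < r" "r < r / q" "1 < r / q" using q by (auto simp: field_simps)
    have exponent: "(r / q) * r / (r / q - r) = r / (1 - q)" using q by (simp add: field_simps)
    let ?a = "\<exists>u. in_Lp_nonneg \<sigma> r u \<and> positive_supersolution G \<sigma> q u"
    let ?b = "\<exists>u. in_Lp_nonneg \<sigma> r u \<and> positive_solution G \<sigma> q u"
    let ?c = "weighted_norm_inequality G \<sigma> (r / q) r"
    let ?d = "(\<integral>\<^sup>+ x. potential G \<sigma> x epowr (r / (1 - q)) \<partial>\<sigma>) < \<infinity>"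
    note equivs = sublinear_equation_equivalences[OF assms(2,3,5) kernel nz q]
    have "?a \<Longrightarrow> ?d" using equivs(1) by blast
    moreover have "?d \<Longrightarrow> ?b" by (rule equivs(2))
    moreover have "?b \<Longrightarrow> ?a" using positive_solution_imp_supersolution by blast
    moreover have "?c \<longleftrightarrow> ?d" using iff[OF p] unfolding exponent .
    ultimately show "(?a \<longleftrightarrow> ?b) \<and> (?b \<longleftrightarrow> ?c) \<and> (?c \<longleftrightarrow> ?d)" by blast
  qed
qed

end
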